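(* Let $K\subset\mathbb{R}$ be a compact interval. Let $(X_n : n \in \mathbb{N})$ be a sequence of continuous mappings defined on $\mathbb{R}$ with values in $\operatorname{GL}(2, \mathbb{R})$ that converges uniformly on $K$ to $\sigma \operatorname{Id}$ for a certain $\sigma \in \{-1, 1\}$. Suppose that there is a sequence of positive numbers $(\gamma_n : n \in \mathbb{N}_0)$ such that $R_n = \gamma_n(X_n - \sigma \operatorname{Id})$ converges uniformly on $K$ to a mapping $\mathcal{R}$ satisfying $\operatorname{discr} \mathcal{R}(x) \neq 0$ for all $x \in K$. If $\operatorname{discr} \mathcal{R} > 0$ on $K$, we additionally assume that $$\sum_{n=0}^\infty \frac{1}{\gamma_n} = \infty.$$ Let $(E_n : n \in \mathbb{N})$ be a sequence of continuous mappings defined on $\mathbb{R}$ with values in $\operatorname{Mat}(2, \mathbb{C})$ such that $$\sum_{n = 1}^\infty \sup_{x\in K}\|E_n(x)\| < \infty.$$ If $(R_n : n \in \mathbb{N})$ belongs to $\mathcal{D}_{1, 0}\big(K, \operatorname{Mat}(2, \mathbb{R})\big)$ and $\eta$ is a continuous eigenvalue of $\mathcal{R}$ (i.e. $\eta:K\to\mathbb{C}$ is continuous and $\eta(x)$ is an eigenvalue of $\mathcal{R}(x)$ for each $x\in K$), then there are $n_0 \geq 1$ and continuous mappings $\Phi_n : K \rightarrow \mathbb{C}^2$, $\mu_n : K \rightarrow \mathbb{C}$ ($n\ge n_0$), and $v : K \rightarrow \mathbb{C}^2$ satisfying $$\Phi_{n+1} = (X_n + E_n) \Phi_n \qquad (n\ge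 n_0),$$ such that $$\lim_{n \to \infty} \sup_{x \in K}\bigg\|\frac{\Phi_n(x)}{\prod_{j = n_0}^{n-1} \big( \sigma + \gamma_j^{-1} \mu_j(x)\big)} - v(x) \bigg\| = 0,$$ where for each $x \in K$, $v(x)$ is an eigenvector of $\mathcal{R}(x)$ corresponding to $\eta(x)$, and $\mu_n(x)$ is an eigenvalue of $R_n(x)$ such that $$\lim_{n \to \infty} \sup_{x \in K}\big|\mu_n(x) - \eta(x)\big| = 0.$$
   Context: For a real $2\times2$ matrix $X$, $\operatorname{discr}X=(\operatorname{tr}X)^2-4\det X$. Matrix spaces carry the operator norm. A sequence $(x_n:n\in\mathbb{N})$ in a normed space $V$ belongs to $\mathcal{D}_{1,0}(V)$ if it is bounded and $\sum_{n=1}^\infty\|x_{n+1}-x_n\|<\infty$; $\mathcal{D}_{1,0}(K,\operatorname{Mat}(2,\mathbb{R}))$ is $\mathcal{D}_{1,0}(V)$ with $V$ the space of continuous maps $K\to\operatorname{Mat}(2,\mathbb{R})$ with the supremum norm. *)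

theory Defs
  imports "HOL-Analysis.Analysis"
begin

text \<open>
  The library norm on matrices is the Euclidean (Frobenius) norm, so the operator norm
  is introduced separately; it is induced by the Euclidean norm on vectors.
\<close>

definition opnorm :: "'a::real_normed_field^'n^'m \<Rightarrow> real" where
  "opnorm A = onorm (\<lambda>v. A *v v)"

text \<open>
  The supremum is only meaningful when \<open>K\<close> is nonempty and \<open>F\<close> is bounded on \<open>K\<close>, e.g. when
  \<open>K\<close> is nonempty and compact and \<open>F\<close> is continuous on \<open>K\<close>.
\<close>

definition sup_opnorm :: "'x set \<Rightarrow> ('x \<Rightarrow> 'a::real_normed_field^'n^'m) \<Rightarrow> real" where
  "sup_opnorm K F = (SUP x\<in>K. opnorm (F x))"

definition discr :: "real^2^2 \<Rightarrow> real" where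
  "discr A = (trace A)\<^sup>2 - 4 * det A"

definition eigenvector :: "'a::field^'n^'n \<Rightarrow> 'a^'n \<Rightarrow> 'a \<Rightarrow> bool" where
  "eigenvector A v k \<longleftrightarrow> v \<noteq> 0 \<and> A *v v = k *s v"

definition eigenvalue :: "'a::field^'n^'n \<Rightarrow> 'a \<Rightarrow> bool" where
  "eigenvalue A k \<longleftrightarrow> (\<exists>v. eigenvector A v k)"

abbreviation cmat :: "real^'n^'m \<Rightarrow> complex^'n^'m" where
  "cmat \<equiv> map_matrix complex_of_real"

text \<open>
  The class \<open>\<D>\<^sub>1\<^sub>,\<^sub>0(V)\<close> for a space with carrier \<open>V\<close> and norm \<open>nrm\<close>. The carrier and the norm are
  explicit because the space of continuous maps on \<open>K\<close> is not a type. Sequences are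
  indexed from \<open>1\<close>; the value at index \<open>0\<close> is irrelevant.
\<close>

definition D10 :: "'v::minus set \<Rightarrow> ('v \<Rightarrow> real) \<Rightarrow> (nat \<Rightarrow> 'v) \<Rightarrow> bool" where
  "D10 V nrm x \<longleftrightarrow>
     (\<forall>n\<ge>1. x n \<in> V) \<and>
     (\<exists>M. \<forall>n\<ge>1. nrm (x n) \<le> M) \<and>
     summable (\<lambda>n. nrm (x (Suc n + 1) - x (Suc n)))"

definition D10_on :: "real set \<Rightarrow> (nat \<Rightarrow> real \<Rightarrow> real^2^2) \<Rightarrow> bool" where
  "D10_on K = D10 {F. continuous_on K F} (sup_opnorm K)"

end

theory Submission
  imports Defs
begin

text \<open>
  The system is a discrete analogue of the differential systems treated by Levinson's theorem:
  a slowly varying diagonalizable part plus a summable perturbation.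

  On the interval \<open>K\<close> the discriminant of the limit \<open>\<R>\<close> has a constant sign, and hence \<open>\<eta>\<close> is one of
  the two branches \<open>(tr \<plusminus> \<surd>discr) / 2\<close> for one fixed sign. The same formula applied to \<open>R\<^sub>n\<close>
  defines \<open>\<mu>\<^sub>n\<close> and the other eigenvalue \<open>\<nu>\<^sub>n\<close>. Eigenvectors that depend continuously on the
  matrix come from a fixed vector \<open>c\<close>: the matrix \<open>T\<^sub>n\<close> with columns \<open>(R\<^sub>n - \<nu>\<^sub>n) c\<close> and
  \<open>(R\<^sub>n - \<mu>\<^sub>n) c\<close> diagonalizes \<open>R\<^sub>n\<close>, and hence \<open>X\<^sub>n = \<sigma> Id + R\<^sub>n / \<gamma>\<^sub>n\<close>, as long as \<open>c\<close> is not an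
  eigenvector. The choice \<open>c = (1, \<i>)\<close> works for positive discriminant and \<open>c = (1, 0)\<close> for
  negative discriminant. Away from discriminant zero \<open>T\<^sub>n\<close> is a Lipschitz function of \<open>R\<^sub>n\<close>
  (\<open>eigbasis_lipschitz\<close>), so the bounded variation of \<open>R\<^sub>n\<close> makes \<open>\<Sum> sup \<parallel>T\<^bsub>n+1\<^esub> - T\<^sub>n\<parallel>\<close> finite.

  Write \<open>d\<^sub>n = \<sigma> + \<mu>\<^sub>n / \<gamma>\<^sub>n\<close> and \<open>d'\<^sub>n = \<sigma> + \<nu>\<^sub>n / \<gamma>\<^sub>n\<close>. The substitution
  \<open>\<Phi>\<^sub>n = (\<Prod>j<n. d\<^sub>j) T\<^sub>n \<psi>\<^sub>n\<close> leads to \<open>\<psi>\<^bsub>n+1\<^esub> = (diag (1, d'\<^sub>n/d\<^sub>n) + G\<^sub>n) \<psi>\<^sub>n\<close> with summable \<open>G\<^sub>n\<close>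
  (\<open>conjugated_step_estimate\<close>), and it remains to find a solution \<open>\<psi>\<close> that converges uniformly to a
  continuous nonvanishing multiple \<open>L\<close> of the first basis vector; then \<open>v\<close> is \<open>L\<close> times the first
  column of the limit of \<open>T\<^sub>n\<close>. There are two situations.

  \<^item> If \<open>\<bar>d'\<^sub>n\<bar> \<ge> \<bar>d\<^sub>n\<bar>\<close>, the value of \<open>\<psi>\<close> is prescribed at infinity and the recurrence is solved
    backwards (\<open>levinson_nondecaying\<close>). This covers negative discriminants, where \<open>d'\<^sub>n\<close> is the
    complex conjugate of \<open>d\<^sub>n\<close>, and real eigenvalues \<open>d\<^sub>n\<close> of \<open>X\<^sub>n\<close> with the smaller modulus.

  \<^item> If \<open>d\<^sub>n\<close> is the real eigenvalue with the larger modulus, then \<open>\<bar>d'\<^sub>n/d\<^sub>n\<bar> \<le> 1 - const / \<gamma>\<^sub>n\<close>, and the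
    recurrence is solved forward (\<open>levinson_decaying\<close>). The divergence of \<open>\<Sum>1/\<gamma>\<^sub>n\<close> forces the second
    coordinate to zero.
\<close>

section \<open>Norms of matrices\<close>

lemma norm_matrix_vector_mult_le:
  fixes A :: "'a::real_normed_algebra_1^'n^'m"
  shows "norm (A *v u) \<le> norm A * norm u"
proof -
  have row: "norm ((A *v u) $ i) \<le> norm (norm (A $ i) * norm u)" for i
  proof -
    have "norm ((A *v u) $ i) \<le> (\<Sum>j\<in>UNIV. \<bar>norm (A $ i $ j)\<bar> * \<bar>norm (u $ j)\<bar>)"
      unfolding matrix_vector_mult_def by (auto intro!: sum_norm_le norm_mult_ineq)
    also have "\<dots> \<le> norm (A $ i) * norm u"
      unfolding norm_vec_def[of "A $ i"] norm_vec_def[of u] by (rule L2_set_mult_ineq)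
    finally show ?thesis by simp
  qed
  have "norm (A *v u) \<le> L2_set (\<lambda>i. norm (A $ i) * norm u) UNIV"
    unfolding norm_vec_def[of "A *v u"] using row by (intro L2_set_mono) auto
  then show ?thesis
    by (simp add: L2_set_left_distrib norm_vec_def[of A])
qed

lemma bounded_bilinear_matrix_vector_mult:
  "bounded_bilinear ((*v) :: 'a::real_normed_algebra_1^'n^'m \<Rightarrow> _)"
proof
  show "\<exists>C. \<forall>A u. norm (A *v u :: 'a^'m) \<le> norm (A :: 'a^'n^'m) * norm u * C"
    by (rule exI[of _ 1]) (simp add: norm_matrix_vector_mult_le)
qed (simp_all add: matrix_vector_mult_def vec_eq_iff sum.distrib distrib_left distrib_right
    scaleR_sum_right)

lemmas continuous_on_matrix_vector_mult [continuous_intros] =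
  bounded_bilinear.continuous_on[OF bounded_bilinear_matrix_vector_mult]

lemma norm_vec_le_sum: "norm (u :: 'a::real_normed_vector^'n) \<le> (\<Sum>i\<in>UNIV. norm (u $ i))"
  by (simp add: norm_vec_def L2_set_le_sum)

lemma norm_matrix_entry_le: "norm (A $ i $ j) \<le> norm A"
  by (rule order_trans[OF Finite_Cartesian_Product.norm_nth_le Finite_Cartesian_Product.norm_nth_le])

lemma opnorm_le_norm:
  fixes A :: "'a::real_normed_field^'n^'m"
  shows "opnorm A \<le> norm A"
  unfolding opnorm_def by (rule onorm_le) (rule norm_matrix_vector_mult_le)

text \<open>
  The hypotheses measure matrices in the operator norm, the estimates below in the Euclidean
  norm; in a fixed dimension the two are comparable because each entry is a coordinate of the
  image of a unit vector.
\<close>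

lemma norm_le_opnorm:
  fixes A :: "'a::real_normed_field^'n^'m"
  shows "norm A \<le> real CARD('m) * real CARD('n) * opnorm A"
proof -
  have entry: "norm (A $ i $ j) \<le> opnorm A" for i j
  proof -
    have "A $ i $ j = (A *v axis j 1) $ i"
      by (simp add: matrix_vector_mult_def axis_def mult_delta_right)
    also have "norm \<dots> \<le> norm (A *v axis j 1)" by (rule Finite_Cartesian_Product.norm_nth_le)
    also have "\<dots> \<le> onorm ((*v) A) * norm (axis j (1::'a))"
      by (rule onorm)
         (rule bounded_bilinear.bounded_linear_right[OF bounded_bilinear_matrix_vector_mult])
    also have "\<dots> \<le> onorm ((*v) A) * 1"
    proof (rule mult_left_mono)
      show "norm (axis j (1::'a)) \<le> 1"
        using norm_vec_le_sum[of "axis j (1::'a)"] by (simp add: axis_def if_distrib[of norm] cong: if_cong)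
    qed (auto intro!: onorm_pos_le
          bounded_bilinear.bounded_linear_right[OF bounded_bilinear_matrix_vector_mult])
    finally show ?thesis by (simp add: opnorm_def)
  qed
  have "norm A \<le> (\<Sum>i\<in>UNIV. norm (A $ i))" by (rule norm_vec_le_sum)
  also have "\<dots> \<le> (\<Sum>i\<in>(UNIV::'m set). \<Sum>j\<in>(UNIV::'n set). opnorm A)"
    by (intro sum_mono order_trans[OF norm_vec_le_sum] entry)
  finally show ?thesis by simp
qed

lemma norm_le_sup_opnorm:
  fixes F :: "'x::topological_space \<Rightarrow> 'a::real_normed_field^'n^'m"
  assumes "compact K" "continuous_on K F" "x \<in> K"
  shows "norm (F x) \<le> real CARD('m) * real CARD('n) * sup_opnorm K F"
proof -
  obtain B where B: "\<And>y. y \<in> K \<Longrightarrow> norm (F y) \<le> B"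
    using compact_imp_bounded[OF compact_continuous_image[OF assms(2,1)]]
    by (auto simp: bounded_iff)
  have "opnorm (F x) \<le> sup_opnorm K F"
    unfolding sup_opnorm_def
    by (rule cSUP_upper[OF assms(3)])
       (auto intro!: bdd_aboveI[of _ B] order_trans[OF opnorm_le_norm] B)
  then show ?thesis
    by (intro order_trans[OF norm_le_opnorm] mult_left_mono) auto
qed

lemma summable_majorant_of_sup_opnorm:
  fixes F :: "nat \<Rightarrow> 'x::topological_space \<Rightarrow> 'a::real_normed_field^'n^'m"
  assumes "compact K" "K \<noteq> {}" "\<And>n. n \<ge> 1 \<Longrightarrow> continuous_on K (F n)"
    and "summable (\<lambda>n. sup_opnorm K (F (Suc n)))"
  shows "\<exists>h. summable h \<and> (\<forall>n. 0 \<le> h n) \<and> (\<forall>n\<ge>1. \<forall>x\<in>K. norm (F n x) \<le> h n)"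
proof -
  \<comment> \<open>Nothing is known at index 0; the value 0 there keeps \<open>h\<close> nonnegative.\<close>
  define h where "h n = (if n = 0 then 0 else real CARD('m) * real CARD('n) * sup_opnorm K (F n))" for n
  have bound: "norm (F n x) \<le> h n" if "n \<ge> 1" "x \<in> K" for n x
    using norm_le_sup_opnorm[OF assms(1) assms(3)[OF that(1)] that(2)] that(1) by (simp add: h_def)
  have "summable (\<lambda>n. h (Suc n))"
    unfolding h_def using assms(4) by (simp add: summable_mult)
  then have "summable h" by (simp only: summable_Suc_iff)
  moreover have "0 \<le> h n" for n
  proof (cases "n = 0")
    case False
    obtain x where "x \<in> K" using assms(2) by blast
    then show ?thesis using order_trans[OF norm_ge_zero bound[of n x]] False by simp
  qed (simp add: h_def)
  ultimately show ?thesis using bound by blast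
qed

section \<open>Uniform limits\<close>

text \<open>
  A continuous map is uniformly continuous on the closed ball that contains a neighbourhood of
  the bounded set \<open>f ` K\<close>, and the approximants eventually take their values there. Every object
  computed from \<open>R\<^sub>n\<close> by a continuous formula thus inherits the uniform convergence.
\<close>

lemma uniform_limit_compose_continuous:
  fixes f :: "'x::topological_space \<Rightarrow> 'b::{real_normed_vector,heine_borel}"
    and g :: "'b \<Rightarrow> 'c::metric_space"
  assumes "compact K" "continuous_on K f" "uniform_limit K F f sequentially"
    and "continuous_on UNIV g"
  shows "uniform_limit K (\<lambda>n x. g (F n x)) (\<lambda>x. g (f x)) sequentially"
proof -
  obtain B where B: "\<And>y. y \<in> K \<Longrightarrow> norm (f y) \<le> B"
    using compact_imp_bounded[OF compact_continuous_image[OF assms(2,1)]]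
    by (auto simp: bounded_iff)
  show ?thesis
  proof (rule uniform_limit_compose_uniformly_continuous_on[OF assms(3)])
    show "uniformly_continuous_on (cball 0 (B + 1)) g"
      using assms(4) by (intro compact_uniformly_continuous) (auto elim: continuous_on_subset)
    show "\<forall>\<^sub>F n in sequentially. \<forall>y\<in>K. F n y \<in> cball 0 (B + 1)"
      using uniform_limitD[OF assms(3) zero_less_one]
    proof eventually_elim
      case (elim n)
      show ?case
      proof
        fix y assume y: "y \<in> K"
        have "norm (F n y) \<le> norm (f y) + dist (F n y) (f y)"
          using norm_triangle_ineq[of "f y" "F n y - f y"] by (simp add: dist_norm)
        then show "F n y \<in> cball 0 (B + 1)"
          using elim[rule_format, OF y] B[OF y] by simp
      qed
    qed
  qed simp
qed

lemma uniform_limit_eventually_ge_pos: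
  fixes f :: "'x::topological_space \<Rightarrow> real"
  assumes "compact K" "continuous_on K f" "uniform_limit K F f sequentially"
    and pos: "\<And>x. x \<in> K \<Longrightarrow> f x > 0"
  shows "\<exists>\<delta>>0. \<forall>\<^sub>F n in sequentially. \<forall>x\<in>K. F n x \<ge> \<delta>"
proof (cases "K = {}")
  case False
  then obtain y where y: "y \<in> K" "\<And>x. x \<in> K \<Longrightarrow> f y \<le> f x"
    using continuous_attains_inf[OF assms(1) False assms(2)] by blast
  have "\<forall>\<^sub>F n in sequentially. \<forall>x\<in>K. dist (F n x) (f x) < f y / 2"
    using pos[OF y(1)] by (intro uniform_limitD[OF assms(3)]) simp
  then have "\<forall>\<^sub>F n in sequentially. \<forall>x\<in>K. F n x \<ge> f y / 2"
    by eventually_elim (use y(2) in \<open>fastforce simp: dist_real_def abs_if split: if_splits\<close>)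
  then show ?thesis using pos[OF y(1)] by (intro exI[of _ "f y / 2"]) simp
qed (auto intro: exI[of _ 1])

lemma uniform_limit_eventually_bounded:
  fixes f :: "'x::topological_space \<Rightarrow> 'b::real_normed_vector"
  assumes "compact K" "continuous_on K f" "uniform_limit K F f sequentially"
  shows "\<exists>B>0. \<forall>\<^sub>F n in sequentially. \<forall>x\<in>K. norm (F n x) \<le> B"
proof -
  obtain B where B: "\<And>y. y \<in> K \<Longrightarrow> norm (f y) \<le> B"
    using compact_imp_bounded[OF compact_continuous_image[OF assms(2,1)]]
    by (auto simp: bounded_iff)
  have "\<forall>\<^sub>F n in sequentially. \<forall>x\<in>K. norm (F n x) \<le> \<bar>B\<bar> + 1"
    using uniform_limitD[OF assms(3) zero_less_one]
  proof eventually_elim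
    case (elim n)
    show ?case
    proof
      fix y assume y: "y \<in> K"
      have "norm (F n y) \<le> norm (f y) + dist (F n y) (f y)"
        using norm_triangle_ineq[of "f y" "F n y - f y"] by (simp add: dist_norm)
      then show "norm (F n y) \<le> \<bar>B\<bar> + 1"
        using elim[rule_format, OF y] B[OF y] by linarith
    qed
  qed
  then show ?thesis by (intro exI[of _ "\<bar>B\<bar> + 1"]) auto
qed

lemma uniform_limit_imp_SUP_tendsto_0:
  fixes f :: "'x \<Rightarrow> 'b::real_normed_vector"
  assumes "uniform_limit K F f sequentially" "K \<noteq> {}"
  shows "(\<lambda>n. SUP x\<in>K. norm (F n x - f x)) \<longlonglongrightarrow> 0"
proof (rule tendstoI)
  fix e :: real assume e: "e > 0"
  have "\<forall>\<^sub>F n in sequentially. \<forall>x\<in>K. dist (F n x) (f x) < e / 2"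
    using e by (intro uniform_limitD[OF assms(1)]) simp
  then show "\<forall>\<^sub>F n in sequentially. dist (SUP x\<in>K. norm (F n x - f x)) 0 < e"
  proof eventually_elim
    case (elim n)
    then have le: "norm (F n x - f x) \<le> e / 2" if "x \<in> K" for x
      using that by (auto simp: dist_norm less_imp_le)
    obtain y where y: "y \<in> K" using assms(2) by blast
    have "0 \<le> norm (F n y - f y)" by simp
    also have "\<dots> \<le> (SUP x\<in>K. norm (F n x - f x))"
      by (rule cSUP_upper[OF y]) (auto intro!: bdd_aboveI[of _ "e / 2"] le)
    finally have "0 \<le> (SUP x\<in>K. norm (F n x - f x))" .
    moreover have "(SUP x\<in>K. norm (F n x - f x)) \<le> e / 2"
      using assms(2) le by (intro cSUP_least) auto
    ultimately show ?case using e by simp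
  qed
qed

text \<open>
  The quantitative form of the Weierstrass test: the distance to the limit is controlled by
  the tail of the majorant, which later serves to keep limits away from zero.
\<close>

lemma uniform_limit_of_summable_increments:
  fixes f :: "nat \<Rightarrow> 'x \<Rightarrow> 'b::banach"
  assumes inc: "\<And>n x. n \<ge> N \<Longrightarrow> x \<in> K \<Longrightarrow> norm (f (Suc n) x - f n x) \<le> h n"
    and h: "summable h"
  shows "\<exists>l. uniform_limit K f l sequentially \<and>
             (\<forall>n\<ge>N. \<forall>x\<in>K. norm (f n x - l x) \<le> (\<Sum>k. h (k + n)))"
proof -
  define l where "l x = f 0 x + (\<Sum>k. f (Suc k) x - f k x)" for x
  have summ: "summable (\<lambda>k. f (Suc k) x - f k x)" if "x \<in> K" for x
    using inc[OF _ that] by (intro summable_comparison_test[OF _ h] exI[of _ N]) blast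
  have bound: "norm (f n x - l x) \<le> (\<Sum>k. h (k + n))" if "n \<ge> N" "x \<in> K" for n x
  proof -
    have "l x - f n x = (\<Sum>k. f (Suc (k + n)) x - f (k + n) x)"
      using suminf_split_initial_segment[OF summ[OF that(2)], of n]
      sum_lessThan_telescope[of "\<lambda>k. f k x" n]
      by (simp add: l_def)
    also have "norm \<dots> \<le> (\<Sum>k. h (k + n))"
      using that h by (intro norm_suminf_le inc summable_ignore_initial_segment) auto
    finally show ?thesis by (simp add: norm_minus_commute)
  qed
  have "uniform_limit K f l sequentially"
  proof (rule uniform_limitI)
    fix e :: real assume "e > 0"
    then obtain M where M: "\<And>n. n \<ge> M \<Longrightarrow> norm (\<Sum>k. h (k + n)) < e"
      using suminf_exist_split[OF _ h] by blast
    show "\<forall>\<^sub>F n in sequentially. \<forall>x\<in>K. dist (f n x) (l x) < e"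
      using eventually_ge_at_top[of "max M N"]
    proof eventually_elim
      case (elim n)
      show ?case
        using M[of n] bound[of n] elim by (force simp: dist_norm)
    qed
  qed
  with bound show ?thesis by blast
qed

section \<open>Recurrences with summable perturbation\<close>

lemma sum_le_tail_suminf:
  fixes g :: "nat \<Rightarrow> real"
  assumes "summable g" "\<And>n. 0 \<le> g n"
  shows "(\<Sum>k=m..<n. g k) \<le> (\<Sum>k. g (k + m))"
proof (cases "m \<le> n")
  case True
  then have "(\<Sum>k=m..<n. g k) = (\<Sum>k<n-m. g (k + m))"
    using sum.shift_bounds_nat_ivl[of g 0 m "n - m"] by (simp flip: atLeast0LessThan)
  also have "\<dots> \<le> (\<Sum>k. g (k + m))"
    using assms by (intro sum_le_suminf summable_ignore_initial_segment) auto
  finally show ?thesis .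
next
  case False
  then show ?thesis
    using assms by (auto intro!: suminf_nonneg summable_ignore_initial_segment)
qed

lemma prod_one_plus_le_exp_suminf:
  fixes h :: "nat \<Rightarrow> real"
  assumes "summable h" "\<And>n. 0 \<le> h n"
  shows "(\<Prod>k=m..<n. 1 + h k) \<le> exp (\<Sum>k. h (k + m))"
proof -
  have "(\<Prod>k=m..<n. 1 + h k) \<le> (\<Prod>k=m..<n. exp (h k))"
    using assms(2) by (intro prod_mono) (auto simp: add_nonneg_nonneg)
  also have "\<dots> = exp (\<Sum>k=m..<n. h k)"
    by (simp add: exp_sum)
  also have "\<dots> \<le> exp (\<Sum>k. h (k + m))"
    using sum_le_tail_suminf[of h m n] assms by simp
  finally show ?thesis .
qed

text \<open>
  Iterating the inequality from an index \<open>m\<close> gives a multiple of \<open>\<Prod>(1 - \<kappa> k) \<le> exp (- \<Sum>\<kappa> k)\<close> plus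
  a tail of \<open>\<Sum>g k\<close>. The tail is made small by choosing \<open>m\<close>, and then the first term by
  letting \<open>n\<close> grow, since the sum of the \<open>\<kappa> k\<close> diverges.
\<close>

lemma perturbed_contraction_tendsto_0:
  fixes f :: "nat \<Rightarrow> 'x \<Rightarrow> 'b::real_normed_vector"
  assumes step: "\<And>n x. n \<ge> N \<Longrightarrow> x \<in> K \<Longrightarrow> norm (f (Suc n) x) \<le> (1 - \<kappa> n) * norm (f n x) + g n"
    and \<kappa>: "\<And>n. n \<ge> N \<Longrightarrow> 0 \<le> \<kappa> n" "\<And>n. n \<ge> N \<Longrightarrow> \<kappa> n \<le> 1"
    and div: "filterlim (\<lambda>m. \<Sum>n<m. \<kappa> n) at_top sequentially"
    and g: "summable g" "\<And>n. 0 \<le> g n"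
    and B: "\<And>x. x \<in> K \<Longrightarrow> norm (f N x) \<le> B"
  shows "uniform_limit K f (\<lambda>_. 0) sequentially"
proof -
  have decay: "norm (f n x) \<le> exp (- (\<Sum>k=m..<n. \<kappa> k)) * norm (f m x) + (\<Sum>k=m..<n. g k)"
    if "N \<le> m" "m \<le> n" "x \<in> K" for m n x
    using that(2)
  proof (induction n rule: dec_induct)
    case (step n)
    have n: "N \<le> n" using step.hyps that(1) by linarith
    let ?E = "exp (- (\<Sum>k=m..<n. \<kappa> k))" and ?G = "\<Sum>k=m..<n. g k"
    have G: "0 \<le> ?G" using g(2) by (simp add: sum_nonneg)
    have "norm (f (Suc n) x) \<le> (1 - \<kappa> n) * norm (f n x) + g n"
      using assms(1)[OF n that(3)] .
    also have "\<dots> \<le> (1 - \<kappa> n) * (?E * norm (f m x) + ?G) + g n"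
      using step.IH \<kappa>(2)[OF n] by (intro add_right_mono mult_left_mono) auto
    also have "\<dots> = (1 - \<kappa> n) * ?E * norm (f m x) + (1 - \<kappa> n) * ?G + g n"
      by (simp add: algebra_simps)
    also have "\<dots> \<le> exp (- \<kappa> n) * ?E * norm (f m x) + 1 * ?G + g n"
      using exp_ge_add_one_self[of "- \<kappa> n"] \<kappa>(1)[OF n] G
      by (intro add_mono mult_right_mono) auto
    also have "\<dots> = exp (- (\<Sum>k=m..<Suc n. \<kappa> k)) * norm (f m x) + (\<Sum>k=m..<Suc n. g k)"
      using step.hyps by (simp flip: exp_add)
    finally show ?case .
  qed simp
  note sum_g = sum_le_tail_suminf[OF g]
  define C where "C = \<bar>B\<bar> + (\<Sum>k. g (k + N))"
  have bdd: "norm (f n x) \<le> C" if "N \<le> n" "x \<in> K" for n x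
  proof -
    have "exp (- (\<Sum>k=N..<n. \<kappa> k)) * norm (f N x) \<le> 1 * \<bar>B\<bar>"
      using \<kappa>(1) B[OF that(2)] by (intro mult_mono) (auto intro!: sum_nonneg)
    then show ?thesis using decay[OF order_refl that] sum_g[of N n] by (simp add: C_def)
  qed
  have C: "C \<ge> 0"
    unfolding C_def using g
    by (intro add_nonneg_nonneg suminf_nonneg summable_ignore_initial_segment) auto
  show ?thesis
  proof (rule uniform_limitI)
    fix e :: real assume e: "e > 0"
    obtain M where M: "\<And>n. n \<ge> M \<Longrightarrow> norm (\<Sum>k. g (k + n)) < e / 2"
      using suminf_exist_split[OF _ g(1), of "e / 2"] e by auto
    define m where "m = max M N"
    have m: "(\<Sum>k. g (k + m)) < e / 2" "N \<le> m" using M[of m] by (auto simp: m_def)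
    \<comment> \<open>The threshold is chosen so that the exponential factor drops below \<open>e / (2 * (C + 1))\<close>;
      the summand 1 keeps the denominator positive when \<open>C = 0\<close>.\<close>
    have "\<forall>\<^sub>F n in sequentially. (\<Sum>k<n. \<kappa> k) > (\<Sum>k<m. \<kappa> k) + ln (2 * (C + 1) / e)"
      using div by (simp add: filterlim_at_top_dense)
    then show "\<forall>\<^sub>F n in sequentially. \<forall>x\<in>K. dist (f n x) 0 < e"
      using eventually_ge_at_top[of m]
    proof eventually_elim
      case (elim n)
      have "(\<Sum>k<n. \<kappa> k) = (\<Sum>k<m. \<kappa> k) + (\<Sum>k=m..<n. \<kappa> k)"
        using elim(2) sum.atLeastLessThan_concat[of 0 m n \<kappa>] by (simp add: atLeast0LessThan)
      then have "ln (2 * (C + 1) / e) < (\<Sum>k=m..<n. \<kappa> k)" using elim(1) by simp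
      then have "exp (- (\<Sum>k=m..<n. \<kappa> k)) < exp (- ln (2 * (C + 1) / e))" by simp
      also have "\<dots> = e / (2 * (C + 1))" using e C by (simp add: exp_minus)
      finally have E: "exp (- (\<Sum>k=m..<n. \<kappa> k)) \<le> e / (2 * (C + 1))" by simp
      show ?case
      proof
        fix x assume x: "x \<in> K"
        have "exp (- (\<Sum>k=m..<n. \<kappa> k)) * norm (f m x) \<le> e / (2 * (C + 1)) * (C + 1)"
          using E bdd[OF m(2) x] C e by (intro mult_mono) auto
        also have "\<dots> = e / 2" using C by (simp add: field_simps)
        finally show "dist (f n x) 0 < e"
          using decay[OF m(2) elim(2) x] sum_g[of m n] m(1) by simp
      qed
    qed
  qed
qed

text \<open>
  The composition \<open>A\<^sub>n \<circ> A\<^bsub>n+1\<^esub> \<circ> \<dots> \<circ> A\<^bsub>n+k-1\<^esub>\<close>: it carries a value prescribed at time \<open>n + k\<close> back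
  to time \<open>n\<close>.
\<close>

primrec backward_iterate :: "(nat \<Rightarrow> 'a \<Rightarrow> 'a) \<Rightarrow> nat \<Rightarrow> nat \<Rightarrow> 'a \<Rightarrow> 'a" where
  "backward_iterate A n 0 u = u"
| "backward_iterate A n (Suc k) u = A n (backward_iterate A (Suc n) k u)"

lemma backward_iterate_Suc_inner:
  "backward_iterate A n (Suc k) u = backward_iterate A n k (A (n + k) u)"
  by (induction k arbitrary: n) simp_all

lemma linear_backward_iterate:
  assumes "\<And>j. j \<ge> n \<Longrightarrow> linear (A j)"
  shows "linear (backward_iterate A n k)"
  using assms
proof (induction k arbitrary: n)
  case 0
  then show ?case by (simp add: linear_id[unfolded id_def] backward_iterate.simps(1)[abs_def])
next
  case (Suc k)
  have "linear (A n \<circ> backward_iterate A (Suc n) k)"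
    using Suc by (intro linear_compose) auto
  then show ?case by (simp add: o_def)
qed

lemma norm_backward_iterate_le:
  fixes A :: "nat \<Rightarrow> 'a::real_normed_vector \<Rightarrow> 'a"
  assumes "\<And>j u. j \<ge> n \<Longrightarrow> norm (A j u) \<le> (1 + h j) * norm u" "\<And>j. 0 \<le> h j"
  shows "norm (backward_iterate A n k u) \<le> (\<Prod>j=n..<n+k. 1 + h j) * norm u"
  using assms(1)
proof (induction k arbitrary: n)
  case (Suc k)
  have "norm (backward_iterate A n (Suc k) u) \<le> (1 + h n) * norm (backward_iterate A (Suc n) k u)"
    using Suc.prems by simp
  also have "\<dots> \<le> (1 + h n) * ((\<Prod>j=Suc n..<Suc n+k. 1 + h j) * norm u)"
    using Suc.prems assms(2) by (intro mult_left_mono Suc.IH) (auto simp: add_nonneg_nonneg)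
  also have "\<dots> = (\<Prod>j=n..<n+Suc k. 1 + h j) * norm u"
    by (subst (2) prod.atLeast_Suc_lessThan) simp_all
  finally show ?case .
qed simp

lemma continuous_on_backward_iterate:
  assumes "\<And>j u. j \<ge> n \<Longrightarrow> continuous_on K u \<Longrightarrow> continuous_on K (\<lambda>x. A x j (u x))"
  shows "continuous_on K (\<lambda>x. backward_iterate (A x) n k c)"
  using assms by (induction k arbitrary: n) auto

text \<open>
  Prescribe the value \<open>e\<close> at a finite time
  \<open>n + k\<close> and run the recurrence backwards to time \<open>n\<close>. Passing from \<open>k\<close> to \<open>k + 1\<close> changes the
  result by the image of \<open>A\<^bsub>n+k\<^esub> e - e\<close>, whose norm is at most \<open>h (n + k)\<close>, under a composition of
  maps that are bounded by \<open>exp (\<Sum>h)\<close>. These changes are summable, uniformly in the parameter,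
  so the limit exists; it solves the recurrence because each map is continuous, and it is close
  to \<open>e\<close> at late times because only the tail of \<open>h\<close> enters.
\<close>

lemma backward_recurrence_solution:
  fixes A :: "nat \<Rightarrow> 'x::topological_space \<Rightarrow> 'a::banach \<Rightarrow> 'a"
  assumes lin: "\<And>n x. n \<ge> N \<Longrightarrow> x \<in> K \<Longrightarrow> linear (A n x)"
    and bound: "\<And>n x u. n \<ge> N \<Longrightarrow> x \<in> K \<Longrightarrow> norm (A n x u) \<le> (1 + h n) * norm u"
    and near: "\<And>n x. n \<ge> N \<Longrightarrow> x \<in> K \<Longrightarrow> norm (A n x e - e) \<le> h n"
    and cont: "\<And>n u. n \<ge> N \<Longrightarrow> continuous_on K u \<Longrightarrow> continuous_on K (\<lambda>x. A n x (u x))"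
    and h: "summable h" "\<And>n. 0 \<le> h n"
  shows "\<exists>\<psi>. (\<forall>n\<ge>N. continuous_on K (\<psi> n)) \<and>
             (\<forall>n\<ge>N. \<forall>x\<in>K. \<psi> n x = A n x (\<psi> (Suc n) x)) \<and>
             uniform_limit K \<psi> (\<lambda>_. e) sequentially"
proof -
  define P where "P n k x = backward_iterate (\<lambda>j. A j x) n k e" for n k x
  define C where "C = exp (suminf h)"
  have prod: "(\<Prod>j=n..<n+k. 1 + h j) \<le> C" for n k
  proof -
    have "(\<Prod>j=n..<n+k. 1 + h j) \<le> (\<Prod>j=0..<n+k. 1 + h j)"
      using h(2) by (intro prod_mono2) (auto simp: add_nonneg_nonneg)
    also have "\<dots> \<le> C"
      using prod_one_plus_le_exp_suminf[OF h, of 0 "n + k"] by (simp add: C_def)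
    finally show ?thesis .
  qed
  have inc: "norm (P n (Suc k) x - P n k x) \<le> C * h (k + n)" if "n \<ge> N" "x \<in> K" for n k x
  proof -
    have "linear (backward_iterate (\<lambda>j. A j x) n k)"
      using that by (intro linear_backward_iterate lin) auto
    then have "P n (Suc k) x - P n k x = backward_iterate (\<lambda>j. A j x) n k (A (n + k) x e - e)"
      by (simp only: P_def backward_iterate_Suc_inner linear_diff)
    also have "norm \<dots> \<le> (\<Prod>j=n..<n+k. 1 + h j) * norm (A (n + k) x e - e)"
      using that h by (intro norm_backward_iterate_le bound) auto
    also have "\<dots> \<le> C * h (n + k)"
      using that h(2) by (intro mult_mono prod near) (auto simp: C_def)
    finally show ?thesis by (simp add: add.commute)
  qed
  have summ: "summable (\<lambda>k. C * h (k + n))" for n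
    using h(1) by (intro summable_mult summable_ignore_initial_segment)
  have "\<exists>l. uniform_limit K (P n) l sequentially \<and>
            (\<forall>x\<in>K. norm (P n 0 x - l x) \<le> (\<Sum>k. C * h (k + n)))" if "n \<ge> N" for n
  proof -
    have "\<exists>l. uniform_limit K (P n) l sequentially \<and>
              (\<forall>m\<ge>0. \<forall>x\<in>K. norm (P n m x - l x) \<le> (\<Sum>k. C * h (k + m + n)))"
      by (rule uniform_limit_of_summable_increments[OF _ summ]) (rule inc[OF that])
    then obtain l where l: "uniform_limit K (P n) l sequentially"
        "\<And>m x. x \<in> K \<Longrightarrow> norm (P n m x - l x) \<le> (\<Sum>k. C * h (k + m + n))"
      by auto
    show ?thesis using l(1) l(2)[of _ 0] by (intro exI[of _ l]) simp
  qed
  then have "\<forall>n\<in>{N..}. \<exists>l. uniform_limit K (P n) l sequentially \<and>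
            (\<forall>x\<in>K. norm (P n 0 x - l x) \<le> (\<Sum>k. C * h (k + n)))" by simp
  from bchoice[OF this] obtain \<psi> where
    \<psi>: "\<And>n. n \<ge> N \<Longrightarrow> uniform_limit K (P n) (\<psi> n) sequentially"
      "\<And>n x. n \<ge> N \<Longrightarrow> x \<in> K \<Longrightarrow> norm (P n 0 x - \<psi> n x) \<le> (\<Sum>k. C * h (k + n))"
    by auto
  have 1: "continuous_on K (\<psi> n)" if "n \<ge> N" for n
  proof (rule uniform_limit_theorem[OF _ \<psi>(1)[OF that]])
    show "\<forall>\<^sub>F k in sequentially. continuous_on K (P n k)"
      unfolding P_def using that
      by (intro always_eventually allI continuous_on_backward_iterate cont) auto
  qed simp
  have 2: "\<psi> n x = A n x (\<psi> (Suc n) x)" if "n \<ge> N" "x \<in> K" for n x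
  proof -
    have "bounded_linear (A n x)"
      using lin[OF that] bound[OF that]
      by (intro bounded_linear_intro[of _ "1 + h n"])
         (auto simp: linear_add linear_scale mult.commute)
    note A_tendsto = bounded_linear.tendsto[OF this]
    have "(\<lambda>k. A n x (P (Suc n) k x)) \<longlonglongrightarrow> A n x (\<psi> (Suc n) x)"
      using that by (intro A_tendsto tendsto_uniform_limitI[OF \<psi>(1)]) auto
    then show ?thesis
    proof (rule LIMSEQ_unique[rotated])
      show "(\<lambda>k. A n x (P (Suc n) k x)) \<longlonglongrightarrow> \<psi> n x"
        using LIMSEQ_Suc[OF tendsto_uniform_limitI[OF \<psi>(1)[OF that(1)] that(2)]]
        by (simp add: P_def)
    qed
  qed
  have 3: "uniform_limit K \<psi> (\<lambda>_. e) sequentially"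
  proof (rule uniform_limitI)
    fix \<epsilon> :: real assume "\<epsilon> > 0"
    then obtain M where M: "\<And>n. n \<ge> M \<Longrightarrow> norm (\<Sum>k. C * h (k + n)) < \<epsilon>"
      using suminf_exist_split[OF _ summable_mult[OF h(1), of C]] by blast
    show "\<forall>\<^sub>F n in sequentially. \<forall>x\<in>K. dist (\<psi> n x) e < \<epsilon>"
      using eventually_ge_at_top[of "max M N"]
    proof eventually_elim
      case (elim n)
      show ?case
      proof
        fix x assume "x \<in> K"
        then show "dist (\<psi> n x) e < \<epsilon>"
          using M[of n] \<psi>(2)[of n x] elim by (simp add: dist_norm P_def norm_minus_commute)
      qed
    qed
  qed
  show ?thesis using 1 2 3 by (intro exI[of _ \<psi>] conjI allI impI ballI)
qed

section \<open>Two-dimensional systems close to diagonal ones\<close>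

definition diag2 :: "'a::zero \<Rightarrow> 'a \<Rightarrow> 'a^2^2" where
  "diag2 p q = (\<chi> i j. if i = j then (if i = 1 then p else q) else 0)"

text \<open>
  Cramer's formula, chosen over an abstract inverse because its continuity and its size can be
  read off from the entries and the determinant.
\<close>

definition inverse2 :: "'a::field^2^2 \<Rightarrow> 'a^2^2" where
  "inverse2 A = (\<chi> i j. (if i = j then (if i = 1 then A$2$2 else A$1$1) else - A$i$j) / det A)"

lemma matrix_vector_mult_2:
  fixes A :: "'a::semiring_1^2^2"
  shows "(A *v u) $ i = A $ i $ 1 * u $ 1 + A $ i $ 2 * u $ 2"
  by (simp add: matrix_vector_mult_def sum_2)

lemma diag2_mult_component:
  fixes p q :: "'a::semiring_1"
  shows "(diag2 p q *v u) $ i = (if i = 1 then p else q) * u $ i"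
  using exhaust_2[of i] by (auto simp: matrix_vector_mult_2 diag2_def)

lemma inverse2_mult:
  assumes "det A \<noteq> 0"
  shows "A *v (inverse2 A *v u) = u" "inverse2 A *v (A *v u) = u"
proof -
  have D: "A$1$1 * A$2$2 - A$1$2 * A$2$1 \<noteq> 0" using assms by (simp add: det_2)
  show "A *v (inverse2 A *v u) = u"
    using D by (simp add: vec_eq_iff forall_2 matrix_vector_mult_2 inverse2_def det_2 divide_simps)
       (simp add: algebra_simps)
  show "inverse2 A *v (A *v u) = u"
    using D by (simp add: vec_eq_iff forall_2 matrix_vector_mult_2 inverse2_def det_2 divide_simps)
       (simp add: algebra_simps)
qed

lemma continuous_on_det2:
  fixes A :: "'x::topological_space \<Rightarrow> 'a::real_normed_field^2^2"
  assumes "continuous_on K A"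
  shows "continuous_on K (\<lambda>x. det (A x))"
  unfolding det_2 using assms by (intro continuous_intros)

lemma continuous_on_inverse2:
  fixes A :: "'x::topological_space \<Rightarrow> 'a::real_normed_field^2^2"
  assumes "continuous_on K A" "\<And>x. x \<in> K \<Longrightarrow> det (A x) \<noteq> 0"
  shows "continuous_on K (\<lambda>x. inverse2 (A x))"
proof -
  have "continuous_on K (\<lambda>x. (if i = j then (if i = 1 then A x $2$2 else A x $1$1) else - A x $i$j)
      / det (A x))" for i j
    by (cases "i = j"; cases "i = 1")
       (use assms continuous_on_det2[OF assms(1)] in \<open>auto intro!: continuous_intros\<close>)
  then show ?thesis
    unfolding inverse2_def by (intro continuous_on_vec_lambda)
qed

lemma norm_axis_1: "norm (axis 1 1 :: 'a::real_normed_field^2) = 1"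
  by (simp add: norm_vec_def L2_set_def sum_2 axis_def)

text \<open>
  If the second diagonal entry does not contract, the distinguished solution cannot be singled out
  by initial data: a small error in the second coordinate would persist or grow. It is
  obtained from its value at infinity. Since \<open>diag (1, q)\<close> does not decrease norms, the perturbed
  matrices are eventually invertible with inverses of norm at most \<open>1 + 2 g n\<close>, and these
  inverses nearly fix the first basis vector.
\<close>

lemma levinson_nondecaying:
  fixes M :: "nat \<Rightarrow> 'x::topological_space \<Rightarrow> 'a::{real_normed_field,banach}^2^2"
  assumes cont: "\<And>n. n \<ge> N \<Longrightarrow> continuous_on K (M n)"
    and close: "\<And>n x u. n \<ge> N \<Longrightarrow> x \<in> K \<Longrightarrow>
                  norm (M n x *v u - diag2 1 (q n x) *v u) \<le> g n * norm u"
    and g: "summable g" "\<And>n. 0 \<le> g n"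
    and q: "\<And>n x. n \<ge> N \<Longrightarrow> x \<in> K \<Longrightarrow> 1 \<le> norm (q n x)"
  shows "\<exists>n0\<ge>N. \<exists>\<psi>. (\<forall>n\<ge>n0. continuous_on K (\<psi> n)) \<and>
           (\<forall>n\<ge>n0. \<forall>x\<in>K. \<psi> (Suc n) x = M n x *v \<psi> n x) \<and>
           uniform_limit K \<psi> (\<lambda>x. axis 1 1) sequentially"
proof -
  let ?e = "axis 1 1 :: 'a^2"
  have "\<forall>\<^sub>F n in sequentially. g n < 1 / 2"
    using order_tendstoD(2)[OF summable_LIMSEQ_zero[OF g(1)], of "1/2"] by simp
  then obtain N1 where N1: "\<And>n. n \<ge> N1 \<Longrightarrow> g n < 1 / 2"
    by (auto simp: eventually_sequentially)
  define n0 where "n0 = max N N1"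
  have small: "g n < 1 / 2" "n \<ge> N" if "n \<ge> n0" for n
    using that N1 by (auto simp: n0_def)
  have expand: "norm u \<le> norm (M n x *v u) + g n * norm u" if "n \<ge> n0" "x \<in> K" for n x u
  proof -
    have "norm (u $ i) \<le> norm ((diag2 1 (q n x) *v u) $ i)" for i
      using mult_right_mono[OF q[OF small(2)[OF that(1)] that(2)], of "norm (u $ i)"]
      by (simp add: diag2_mult_component norm_mult)
    then have "norm u \<le> norm (diag2 1 (q n x) *v u)" by (rule norm_le_componentwise_cart)
    also have "\<dots> \<le> norm (M n x *v u) + norm (M n x *v u - diag2 1 (q n x) *v u)"
      using norm_triangle_ineq4[of "M n x *v u" "M n x *v u - diag2 1 (q n x) *v u"] by simp
    finally show ?thesis using close[OF small(2)[OF that(1)] that(2), of u] by linarith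
  qed
  have det: "det (M n x) \<noteq> 0" if "n \<ge> n0" "x \<in> K" for n x
  proof -
    have "u = 0" if "M n x *v u = 0" for u
    proof (rule ccontr)
      assume "u \<noteq> 0"
      then have "g n * norm u < 1 / 2 * norm u"
        using small(1)[OF \<open>n \<ge> n0\<close>] by (intro mult_strict_right_mono) auto
      then show False
        using expand[OF \<open>n \<ge> n0\<close> \<open>x \<in> K\<close>, of u] that \<open>u \<noteq> 0\<close> by simp
    qed
    then have "invertible (M n x)"
      by (simp add: invertible_left_inverse matrix_left_invertible_ker)
    then show ?thesis by (simp add: invertible_det_nz)
  qed
  have bound: "norm (inverse2 (M n x) *v u) \<le> (1 + 2 * g n) * norm u"
    if "n \<ge> n0" "x \<in> K" for n x u
  proof -
    let ?v = "inverse2 (M n x) *v u"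
    have "(1 - g n) * norm ?v \<le> norm u"
      using expand[OF that, of ?v] by (simp add: inverse2_mult(1)[OF det[OF that]] algebra_simps)
    \<comment> \<open>For \<open>0 \<le> g \<le> 1/2\<close> one has \<open>(1 + 2 g) (1 - g) = 1 + g (1 - 2 g) \<ge> 1\<close>.\<close>
    then have "(1 + 2 * g n) * ((1 - g n) * norm ?v) \<le> (1 + 2 * g n) * norm u"
      using g(2)[of n] by (intro mult_left_mono) auto
    moreover have "1 * norm ?v \<le> ((1 + 2 * g n) * (1 - g n)) * norm ?v"
    proof (rule mult_right_mono)
      have "0 \<le> g n * (1 - 2 * g n)"
        using small(1)[OF that(1)] g(2)[of n] by (intro mult_nonneg_nonneg) auto
      then show "1 \<le> (1 + 2 * g n) * (1 - g n)" by (simp add: algebra_simps)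
    qed simp
    ultimately show ?thesis by (simp add: mult.assoc)
  qed
  have near: "norm (inverse2 (M n x) *v ?e - ?e) \<le> 2 * g n" if "n \<ge> n0" "x \<in> K" for n x
  proof -
    have e: "diag2 1 (q n x) *v ?e = ?e"
      by (simp add: vec_eq_iff diag2_mult_component axis_def forall_2)
    have "inverse2 (M n x) *v ?e - ?e = inverse2 (M n x) *v (?e - M n x *v ?e)"
      by (simp add: inverse2_mult(2)[OF det[OF that]] matrix_vector_mult_diff_distrib)
    also have "norm \<dots> \<le> (1 + 2 * g n) * norm (?e - M n x *v ?e)" by (rule bound[OF that])
    also have "\<dots> \<le> (1 + 2 * g n) * g n"
      using close[OF small(2)[OF that(1)] that(2), of ?e] g(2)[of n]
      by (intro mult_left_mono) (auto simp: e norm_axis_1 norm_minus_commute)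
    also have "\<dots> \<le> 2 * g n"
      using small(1)[OF that(1)] g(2)[of n] by (intro mult_right_mono) auto
    finally show ?thesis .
  qed
  have "\<exists>\<psi>. (\<forall>n\<ge>n0. continuous_on K (\<psi> n)) \<and>
             (\<forall>n\<ge>n0. \<forall>x\<in>K. \<psi> n x = inverse2 (M n x) *v \<psi> (Suc n) x) \<and>
             uniform_limit K \<psi> (\<lambda>_. ?e) sequentially"
  proof (rule backward_recurrence_solution[where h = "\<lambda>n. 2 * g n"])
    fix n and u :: "'x \<Rightarrow> 'a^2"
    assume "n \<ge> n0" "continuous_on K u"
    then show "continuous_on K (\<lambda>x. inverse2 (M n x) *v u x)"
      using cont[OF small(2)] det
      by (intro continuous_on_matrix_vector_mult continuous_on_inverse2) auto
  next
    fix n x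
    show "linear ((*v) (inverse2 (M n x)))"
      using bounded_bilinear.bounded_linear_right[OF bounded_bilinear_matrix_vector_mult]
      by (rule bounded_linear.linear)
  qed (use bound near g in \<open>auto intro: summable_mult\<close>)
  then obtain \<psi> where \<psi>: "\<forall>n\<ge>n0. continuous_on K (\<psi> n)"
      "\<And>n x. n \<ge> n0 \<Longrightarrow> x \<in> K \<Longrightarrow> \<psi> n x = inverse2 (M n x) *v \<psi> (Suc n) x"
      "uniform_limit K \<psi> (\<lambda>_. ?e) sequentially"
    by blast
  have "\<psi> (Suc n) x = M n x *v \<psi> n x" if "n \<ge> n0" "x \<in> K" for n x
    by (subst \<psi>(2)[OF that]) (simp only: inverse2_mult(1)[OF det[OF that]])
  then show ?thesis
    using \<psi>(1,3) by (intro exI[of _ n0] exI[of _ \<psi>] conjI allI impI ballI) (auto simp: n0_def)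
qed

text \<open>
  If the second diagonal entry contracts with a divergent total rate, solve forward from the
  first basis vector at a late time \<open>n0\<close>. The first coordinate then moves by summable amounts of
  total size at most \<open>1/2\<close>, so that it converges to a limit that does not vanish, while the second
  coordinate is contracted to zero. The limit is a continuous multiple \<open>L\<close> of the first basis
  vector rather than the vector itself.
\<close>

lemma levinson_decaying:
  fixes M :: "nat \<Rightarrow> 'x::topological_space \<Rightarrow> 'a::{real_normed_field,banach}^2^2"
  assumes cont: "\<And>n. n \<ge> N \<Longrightarrow> continuous_on K (M n)"
    and close: "\<And>n x u. n \<ge> N \<Longrightarrow> x \<in> K \<Longrightarrow>
                  norm (M n x *v u - diag2 1 (q n x) *v u) \<le> g n * norm u"
    and g: "summable g" "\<And>n. 0 \<le> g n"
    and q: "\<And>n x. n \<ge> N \<Longrightarrow> x \<in> K \<Longrightarrow> norm (q n x) \<le> 1 - \<kappa> n"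
    and \<kappa>: "\<And>n. n \<ge> N \<Longrightarrow> 0 \<le> \<kappa> n" "\<And>n. n \<ge> N \<Longrightarrow> \<kappa> n \<le> 1"
    and div: "filterlim (\<lambda>m. \<Sum>n<m. \<kappa> n) at_top sequentially"
  shows "\<exists>n0\<ge>N. \<exists>\<psi> L. (\<forall>n\<ge>n0. continuous_on K (\<psi> n)) \<and> continuous_on K L \<and>
           (\<forall>x\<in>K. L x \<noteq> 0) \<and>
           (\<forall>n\<ge>n0. \<forall>x\<in>K. \<psi> (Suc n) x = M n x *v \<psi> n x) \<and>
           uniform_limit K \<psi> (\<lambda>x. L x *s axis 1 1) sequentially"
proof -
  let ?e = "axis 1 1 :: 'a^2"
  \<comment> \<open>With tail below \<open>1/4\<close> the solution stays below \<open>exp (1/4) \<le> 2\<close>, hence its first coordinate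
    moves by less than \<open>2 / 4\<close> away from its initial value 1.\<close>
  obtain N1 where N1: "\<And>n. n \<ge> N1 \<Longrightarrow> norm (\<Sum>k. g (k + n)) < 1 / 4"
    using suminf_exist_split[OF _ g(1), of "1/4"] by auto
  define n0 where "n0 = max N N1"
  have n0: "n0 \<ge> N" and tail: "(\<Sum>k. g (k + n0)) < 1 / 4"
    using N1[of n0] by (auto simp: n0_def)
  define \<psi> where "\<psi> n x = rec_nat ?e (\<lambda>k u. M (n0 + k) x *v u) (n - n0)" for n x
  have \<psi>0: "\<psi> n0 x = ?e" for x by (simp add: \<psi>_def)
  have \<psi>_Suc: "\<psi> (Suc n) x = M n x *v \<psi> n x" if "n \<ge> n0" for n x
    using that by (simp add: \<psi>_def Suc_diff_le)
  have \<psi>_cont: "continuous_on K (\<psi> n)" if "n \<ge> n0" for n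
    using that
  proof (induction n rule: dec_induct)
    case base
    then show ?case by (simp add: \<psi>0)
  next
    case (step n)
    then have "continuous_on K (\<lambda>x. M n x *v \<psi> n x)"
      using n0 by (intro continuous_on_matrix_vector_mult cont) auto
    then show ?case using step.hyps by (simp add: \<psi>_Suc)
  qed
  have diff: "norm ((\<psi> (Suc n) x - diag2 1 (q n x) *v \<psi> n x) $ i) \<le> g n * norm (\<psi> n x)"
    if "n \<ge> n0" "x \<in> K" for n x i
    using that n0 close[of n x "\<psi> n x"]
    by (intro order_trans[OF Finite_Cartesian_Product.norm_nth_le]) (simp add: \<psi>_Suc)
  have bound: "norm (\<psi> n x) \<le> 2" if "n \<ge> n0" "x \<in> K" for n x
  proof -
    have "norm (\<psi> n x) \<le> (\<Prod>k=n0..<n. 1 + g k)"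
      using that(1)
    proof (induction n rule: dec_induct)
      case base
      then show ?case by (simp add: \<psi>0 norm_axis_1)
    next
      case (step n)
      have n: "n \<ge> N" using step.hyps n0 by simp
      have "norm ((diag2 1 (q n x) *v \<psi> n x) $ i) \<le> norm (\<psi> n x $ i)" for i
        using q[OF n that(2)] \<kappa>(1)[OF n] mult_right_mono[of "norm (q n x)" 1 "norm (\<psi> n x $ i)"]
        by (auto simp: diag2_mult_component norm_mult)
      then have "norm (diag2 1 (q n x) *v \<psi> n x) \<le> norm (\<psi> n x)"
        by (rule norm_le_componentwise_cart)
      moreover have "norm (\<psi> (Suc n) x) \<le> norm (diag2 1 (q n x) *v \<psi> n x)
          + norm (\<psi> (Suc n) x - diag2 1 (q n x) *v \<psi> n x)"
        using norm_triangle_ineq[of "diag2 1 (q n x) *v \<psi> n x"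
            "\<psi> (Suc n) x - diag2 1 (q n x) *v \<psi> n x"] by simp
      ultimately have "norm (\<psi> (Suc n) x) \<le> (1 + g n) * norm (\<psi> n x)"
        using close[OF n that(2), of "\<psi> n x"] step.hyps by (simp add: \<psi>_Suc algebra_simps)
      also have "\<dots> \<le> (1 + g n) * (\<Prod>k=n0..<n. 1 + g k)"
        using step.IH g(2)[of n] by (intro mult_left_mono) auto
      finally show ?case using step.hyps by (simp add: mult.commute)
    qed
    also have "\<dots> \<le> exp (\<Sum>k. g (k + n0))" by (rule prod_one_plus_le_exp_suminf[OF g])
    also have "\<dots> \<le> exp (1 / 4)" using tail by simp
    also have "\<dots> \<le> 2" using exp_bound_half[of "1/4 :: real"] by simp
    finally show ?thesis .
  qed
  have g2: "g n * norm (\<psi> n x) \<le> 2 * g n" if "n \<ge> n0" "x \<in> K" for n x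
    using mult_left_mono[OF bound[OF that] g(2)[of n]] by (simp add: mult.commute)
  have first: "norm (\<psi> (Suc n) x $ 1 - \<psi> n x $ 1) \<le> 2 * g n" if "n \<ge> n0" "x \<in> K" for n x
    using diff[OF that, of 1] g2[OF that] by (simp add: diag2_mult_component)
  obtain L where L: "uniform_limit K (\<lambda>n x. \<psi> n x $ 1) L sequentially"
      "\<And>x. x \<in> K \<Longrightarrow> norm (\<psi> n0 x $ 1 - L x) \<le> (\<Sum>k. 2 * g (k + n0))"
    using uniform_limit_of_summable_increments[of n0 K "\<lambda>n x. \<psi> n x $ 1" "\<lambda>n. 2 * g n", OF first]
      summable_mult[OF g(1), of 2] by auto
  have L_cont: "continuous_on K L"
  proof (rule uniform_limit_theorem[OF _ L(1)])
    show "\<forall>\<^sub>F n in sequentially. continuous_on K (\<lambda>x. \<psi> n x $ 1)"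
      using eventually_ge_at_top[of n0]
      by eventually_elim (intro continuous_on_component \<psi>_cont)
  qed simp
  have L_nz: "L x \<noteq> 0" if "x \<in> K" for x
  proof
    assume "L x = 0"
    then have "1 \<le> (\<Sum>k. 2 * g (k + n0))"
      using L(2)[OF that] by (simp add: \<psi>0 axis_def)
    also have "\<dots> = 2 * (\<Sum>k. g (k + n0))"
      using g(1) by (intro suminf_mult summable_ignore_initial_segment)
    finally show False using tail by simp
  qed
  have second: "uniform_limit K (\<lambda>n x. \<psi> n x $ 2) (\<lambda>_. 0) sequentially"
  proof (rule perturbed_contraction_tendsto_0[where N = n0 and g = "\<lambda>n. 2 * g n" and B = 0])
    fix n x assume nx: "n \<ge> n0" "x \<in> K"
    have "norm (\<psi> (Suc n) x $ 2) \<le> norm (q n x * \<psi> n x $ 2) + 2 * g n"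
      using norm_triangle_ineq[of "q n x * \<psi> n x $ 2" "\<psi> (Suc n) x $ 2 - q n x * \<psi> n x $ 2"]
        diff[OF nx, of 2] g2[OF nx] by (simp add: diag2_mult_component)
    also have "\<dots> \<le> (1 - \<kappa> n) * norm (\<psi> n x $ 2) + 2 * g n"
      using q[of n x] nx n0 by (auto simp: norm_mult intro!: mult_right_mono)
    finally show "norm (\<psi> (Suc n) x $ 2) \<le> (1 - \<kappa> n) * norm (\<psi> n x $ 2) + 2 * g n" .
  qed (use n0 \<kappa> div g in \<open>auto simp: \<psi>0 axis_def intro: summable_mult\<close>)
  have "uniform_limit K \<psi> (\<lambda>x. L x *s ?e) sequentially"
  proof (rule uniform_limitI)
    fix \<epsilon> :: real assume \<epsilon>: "\<epsilon> > 0"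
    have "\<forall>\<^sub>F n in sequentially. \<forall>x\<in>K. dist (\<psi> n x $ 1) (L x) < \<epsilon> / 2"
         "\<forall>\<^sub>F n in sequentially. \<forall>x\<in>K. dist (\<psi> n x $ 2) 0 < \<epsilon> / 2"
      using \<epsilon> by (intro uniform_limitD[OF L(1)] uniform_limitD[OF second]; simp)+
    then show "\<forall>\<^sub>F n in sequentially. \<forall>x\<in>K. dist (\<psi> n x) (L x *s ?e) < \<epsilon>"
    proof eventually_elim
      case (elim n)
      show ?case
      proof
        fix x assume x: "x \<in> K"
        have "dist (\<psi> n x) (L x *s ?e) \<le> norm (\<psi> n x $ 1 - L x) + norm (\<psi> n x $ 2)"
          using norm_vec_le_sum[of "\<psi> n x - L x *s ?e"] by (simp add: dist_norm sum_2 axis_def)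
        then show "dist (\<psi> n x) (L x *s ?e) < \<epsilon>"
          using elim[rule_format, OF x] by (simp add: dist_norm)
      qed
    qed
  qed
  then show ?thesis
    using n0 \<psi>_cont L_cont L_nz \<psi>_Suc
    by (intro exI[of _ n0] exI[of _ \<psi>] exI[of _ L] conjI allI impI ballI)
qed

section \<open>Eigenvalues and eigenvectors of real two by two matrices\<close>

definition discr_root :: "real^2^2 \<Rightarrow> complex" where
  "discr_root A = csqrt (complex_of_real (discr A))"

text \<open>
  For \<open>\<epsilon> = 1\<close> and \<open>\<epsilon> = -1\<close> these are the two roots of the characteristic polynomial.
\<close>

definition eigval :: "real \<Rightarrow> real^2^2 \<Rightarrow> complex" where
  "eigval \<epsilon> A = (complex_of_real (trace A) + complex_of_real \<epsilon> * discr_root A) / 2"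

text \<open>
  For \<open>\<epsilon> = 1\<close> and \<open>\<epsilon> = -1\<close> the columns are \<open>(A - \<nu>) c\<close> and \<open>(A - \<mu>) c\<close>, where \<open>\<mu>\<close> is the eigenvalue
  \<open>eigval \<epsilon> A\<close> and \<open>\<nu>\<close> the other one. By the Cayley-Hamilton theorem they are killed by \<open>A - \<mu>\<close> and
  \<open>A - \<nu>\<close>, respectively. With a fixed vector \<open>c\<close> this selects eigenvectors by one formula that is continuous in
  \<open>A\<close>; the only question is whether the columns are independent.
\<close>

definition eigbasis :: "real \<Rightarrow> complex^2 \<Rightarrow> real^2^2 \<Rightarrow> complex^2^2" where
  "eigbasis \<epsilon> c A = (\<chi> i j. (cmat A *v c) $ i - eigval (if j = 1 then - \<epsilon> else \<epsilon>) A * c $ i)"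

lemma trace_2: "trace (A :: 'a::semiring_1^2^2) = A$1$1 + A$2$2"
  by (simp add: trace_def sum_2)

lemma discr_2: "discr A = (A$1$1 - A$2$2)\<^sup>2 + 4 * A$1$2 * A$2$1"
  by (simp add: discr_def trace_2 det_2 power2_eq_square algebra_simps)

lemma cmat_component [simp]: "cmat A $ i $ j = complex_of_real (A $ i $ j)"
  by (simp add: map_matrix_def)

lemma norm_cmat: "norm (cmat A) = norm A"
  by (simp add: norm_vec_def)

lemma eigval_add: "eigval \<epsilon> A + eigval (- \<epsilon>) A = complex_of_real (trace A)"
  by (simp add: eigval_def field_simps)

lemma eigval_diff: "eigval \<epsilon> A - eigval (- \<epsilon>) A = complex_of_real \<epsilon> * discr_root A"
  by (simp add: eigval_def field_simps)

lemma eigval_mult: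
  assumes "\<epsilon>\<^sup>2 = 1"
  shows "eigval \<epsilon> A * eigval (- \<epsilon>) A = complex_of_real (det A)"
proof -
  have e: "(complex_of_real \<epsilon>)\<^sup>2 = 1"
    using assms by (metis of_real_1 of_real_power)
  have "eigval \<epsilon> A * eigval (- \<epsilon>) A
      = ((complex_of_real (trace A))\<^sup>2 - (complex_of_real \<epsilon>)\<^sup>2 * (discr_root A)\<^sup>2) / 4"
    by (simp add: eigval_def power2_eq_square field_simps)
  also have "(discr_root A)\<^sup>2 = complex_of_real ((trace A)\<^sup>2 - 4 * det A)"
    by (simp add: discr_root_def discr_def)
  finally show ?thesis by (simp add: e)
qed

text \<open>
  The Cayley-Hamilton theorem \<open>(A - \<mu>) (A - \<nu>) = 0\<close>, written out in coordinates.
\<close>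

lemma eigbasis_diagonalizes:
  assumes "\<epsilon>\<^sup>2 = 1"
  shows "cmat A *v (eigbasis \<epsilon> c A *v u)
       = eigbasis \<epsilon> c A *v (diag2 (eigval \<epsilon> A) (eigval (- \<epsilon>) A) *v u)"
proof -
  define p q where "p = eigval \<epsilon> A" and "q = eigval (- \<epsilon>) A"
  define a b d e where "a = complex_of_real (A$1$1)" and "b = complex_of_real (A$1$2)"
    and "d = complex_of_real (A$2$1)" and "e = complex_of_real (A$2$2)"
  have sum: "p + q = a + e"
    by (simp add: p_def q_def eigval_add trace_2 a_def e_def)
  have prod: "p * q = a * e - b * d"
    by (simp add: p_def q_def eigval_mult[OF assms] det_2 a_def b_def d_def e_def)
  show ?thesis
    unfolding vec_eq_iff forall_2
    by (simp add: matrix_vector_mult_2 eigbasis_def diag2_def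
        flip: p_def q_def a_def b_def d_def e_def, intro conjI; use sum prod in algebra)
qed

lemma det_eigbasis:
  "det (eigbasis \<epsilon> c A) = complex_of_real \<epsilon> * discr_root A *
     (c $ 1 * (cmat A *v c) $ 2 - c $ 2 * (cmat A *v c) $ 1)"
proof -
  have "det (eigbasis \<epsilon> c A) = (eigval \<epsilon> A - eigval (- \<epsilon>) A) *
      (c $ 1 * (cmat A *v c) $ 2 - c $ 2 * (cmat A *v c) $ 1)"
    by (simp add: det_2 eigbasis_def algebra_simps)
  then show ?thesis by (simp only: eigval_diff)
qed

lemma discr_root_eq_0_iff [simp]: "discr_root A = 0 \<longleftrightarrow> discr A = 0"
  by (simp add: discr_root_def)

text \<open>
  The determinant vanishes only if \<open>c\<close> is an eigenvector. When the discriminant is positive, the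
  eigenlines are spanned by real vectors, and \<open>(1, \<i>)\<close> is not proportional to a real vector.
\<close>

lemma det_eigbasis_nonzero_pos:
  assumes "\<epsilon> \<noteq> 0" "discr A > 0"
  shows "det (eigbasis \<epsilon> (vector [1, \<i>]) A) \<noteq> 0"
proof -
  let ?c = "vector [1, \<i>] :: complex^2"
  have "?c $ 1 * (cmat A *v ?c) $ 2 - ?c $ 2 * (cmat A *v ?c) $ 1
      = Complex (A$1$2 + A$2$1) (A$2$2 - A$1$1)"
    by (simp add: matrix_vector_mult_2 vector_2 complex_eq_iff)
  moreover have "Complex (A$1$2 + A$2$1) (A$2$2 - A$1$1) \<noteq> 0"
  proof
    assume "Complex (A$1$2 + A$2$1) (A$2$2 - A$1$1) = 0"
    then have "A$2$1 = - A$1$2" "A$2$2 = A$1$1" by (simp_all add: complex_eq_iff)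
    then have "discr A = - 4 * (A$1$2)\<^sup>2" by (simp add: discr_2 power2_eq_square)
    then show False using assms(2) zero_le_power2[of "A$1$2"] by linarith
  qed
  ultimately show ?thesis
    using assms unfolding det_eigbasis by simp
qed

text \<open>
  When the discriminant is negative, the eigenvalues are not real and hence no real vector is an
  eigenvector.
\<close>

lemma det_eigbasis_nonzero_neg:
  assumes "\<epsilon> \<noteq> 0" "discr A < 0"
  shows "det (eigbasis \<epsilon> (vector [1, 0]) A) \<noteq> 0"
proof -
  have "A$2$1 \<noteq> 0"
    using assms(2) zero_le_power2[of "A$1$1 - A$2$2"] by (auto simp: discr_2)
  then show ?thesis
    using assms unfolding det_eigbasis by (simp add: matrix_vector_mult_2 vector_2)
qed

lemma eigenvalue_cmat_cases:
  assumes "eigenvalue (cmat A) k"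
  shows "k = eigval 1 A \<or> k = eigval (-1) A"
proof -
  obtain v where v: "v \<noteq> 0" "cmat A *v v = k *s v"
    using assms by (auto simp: eigenvalue_def eigenvector_def)
  define p q where "p = eigval 1 A" and "q = eigval (- 1) A"
  define a b d e where "a = complex_of_real (A$1$1)" and "b = complex_of_real (A$1$2)"
    and "d = complex_of_real (A$2$1)" and "e = complex_of_real (A$2$2)"
  have sum: "p + q = a + e"
    by (simp add: p_def q_def eigval_add trace_2 a_def e_def)
  have prod: "p * q = a * e - b * d"
    by (simp add: p_def q_def eigval_mult det_2 a_def b_def d_def e_def)
  have v12: "a * v$1 + b * v$2 = k * v$1" "d * v$1 + e * v$2 = k * v$2"
    using v(2) by (simp_all add: vec_eq_iff forall_2 matrix_vector_mult_2 a_def b_def d_def e_def)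
  have "(k - p) * (k - q) * v$1 = 0" "(k - p) * (k - q) * v$2 = 0"
    using sum prod v12 by algebra+
  then have "(k - p) * (k - q) = 0"
    using v(1) by (auto simp: vec_eq_iff forall_2)
  then show ?thesis by (auto simp: p_def q_def)
qed

lemma eigenvector_eigbasis:
  assumes "\<epsilon>\<^sup>2 = 1" "det (eigbasis \<epsilon> c A) \<noteq> 0" "l \<noteq> 0"
  shows "eigenvector (cmat A) (eigbasis \<epsilon> c A *v (l *s axis 1 1)) (eigval \<epsilon> A)"
proof -
  let ?u = "l *s axis 1 1 :: complex^2"
  have u: "?u \<noteq> 0" using assms(3) by (simp add: vec_eq_iff axis_def forall_2)
  have "eigbasis \<epsilon> c A *v ?u \<noteq> 0"
  proof
    assume "eigbasis \<epsilon> c A *v ?u = 0"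
    then have "inverse2 (eigbasis \<epsilon> c A) *v (eigbasis \<epsilon> c A *v ?u) = 0" by simp
    then show False using u inverse2_mult(2)[OF assms(2)] by simp
  qed
  moreover have "diag2 (eigval \<epsilon> A) (eigval (- \<epsilon>) A) *v ?u = eigval \<epsilon> A *s ?u"
    by (simp add: vec_eq_iff forall_2 diag2_mult_component axis_def)
  ultimately show ?thesis
    unfolding eigenvector_def eigbasis_diagonalizes[OF assms(1)]
    by (simp only: vector_scalar_commute) simp
qed

lemma continuous_on_discr: "continuous_on UNIV discr"
  unfolding discr_2[abs_def] by (intro continuous_intros)

lemma continuous_on_discr_root: "continuous_on UNIV discr_root"
proof -
  have eq: "discr_root A = complex_of_real (sqrt (max (discr A) 0))
      + \<i> * complex_of_real (sqrt (max (- discr A) 0))" for A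
    by (cases "discr A \<ge> 0") (simp_all add: discr_root_def csqrt_of_real')
  show ?thesis
    unfolding eq[abs_def] by (intro continuous_intros continuous_on_discr)
qed

lemma continuous_on_eigval: "continuous_on UNIV (eigval \<epsilon>)"
  unfolding eigval_def[abs_def] trace_2
  by (intro continuous_intros continuous_on_discr_root) auto

lemma continuous_on_eigbasis: "continuous_on UNIV (eigbasis \<epsilon> c)"
  unfolding eigbasis_def[abs_def] matrix_vector_mult_2 cmat_component
  by (intro continuous_intros continuous_on_vec_lambda continuous_on_eigval)

text \<open>
  On either half axis the square root stays on one ray, so that
  \<open>\<bar>\<surd>x - \<surd>y\<bar> (\<bar>\<surd>x\<bar> + \<bar>\<surd>y\<bar>) = \<bar>x - y\<bar>\<close>. The number \<open>\<tau>\<close> is the common sign of \<open>x\<close> and \<open>y\<close>.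
\<close>

lemma csqrt_of_real_lipschitz:
  assumes "\<tau> \<in> {-1, 1}" "0 < \<delta>" "\<delta> \<le> \<tau> * x" "\<delta> \<le> \<tau> * y"
  shows "norm (csqrt (complex_of_real x) - csqrt (complex_of_real y)) \<le> \<bar>x - y\<bar> / sqrt \<delta>"
proof -
  have sqrt_diff: "\<bar>sqrt r - sqrt s\<bar> \<le> \<bar>r - s\<bar> / sqrt \<delta>" if "\<delta> \<le> r" "\<delta> \<le> s" for r s
  proof -
    have "\<bar>sqrt r - sqrt s\<bar> * sqrt \<delta> \<le> \<bar>sqrt r - sqrt s\<bar> * (sqrt r + sqrt s)"
      using that assms(2) by (intro mult_left_mono add_increasing2) auto
    also have "\<dots> = \<bar>(sqrt r - sqrt s) * (sqrt r + sqrt s)\<bar>"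
      using that assms(2) by (simp add: abs_mult)
    also have "(sqrt r - sqrt s) * (sqrt r + sqrt s) = r - s"
      using that assms(2) by (simp add: algebra_simps)
    finally show ?thesis using assms(2) by (simp add: field_simps)
  qed
  consider "\<tau> = 1" | "\<tau> = -1" using assms(1) by auto
  then show ?thesis
  proof cases
    case 1
    then have "csqrt (complex_of_real x) - csqrt (complex_of_real y) = complex_of_real (sqrt x - sqrt y)"
      using assms by (simp add: csqrt_of_real')
    then show ?thesis using sqrt_diff[of x y] 1 assms by (simp only: norm_of_real mult_1)
  next
    case 2
    then have "csqrt (complex_of_real x) - csqrt (complex_of_real y)
        = \<i> * complex_of_real (sqrt (- x) - sqrt (- y))"
      using assms by (simp add: csqrt_of_real' algebra_simps)
    then show ?thesis
      using sqrt_diff[of "- x" "- y"] 2 assms by (simp only: norm_mult norm_of_real norm_ii) (simp add: abs_minus_commute)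
  qed
qed

lemma discr_lipschitz:
  assumes "norm A \<le> B" "norm A' \<le> B"
  shows "\<bar>discr A - discr A'\<bar> \<le> 16 * B * norm (A - A')"
proof -
  define D where "D = norm (A - A')"
  have entry: "\<bar>A$i$j\<bar> \<le> B" "\<bar>A'$i$j\<bar> \<le> B" "\<bar>A$i$j - A'$i$j\<bar> \<le> D" for i j
    using norm_matrix_entry_le[of A i j] norm_matrix_entry_le[of A' i j]
      norm_matrix_entry_le[of "A - A'" i j] assms by (auto simp: D_def)
  let ?a = "A$1$1" and ?b = "A$1$2" and ?c = "A$2$1" and ?d = "A$2$2"
  let ?a' = "A'$1$1" and ?b' = "A'$1$2" and ?c' = "A'$2$1" and ?d' = "A'$2$2"
  define p q r where "p = ((?a - ?a') - (?d - ?d')) * ((?a - ?d) + (?a' - ?d'))"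
    and "q = ?b * (?c - ?c')" and "r = (?b - ?b') * ?c'"
  have "\<bar>p\<bar> \<le> (2 * D) * (4 * B)"
    unfolding p_def abs_mult using entry[of 1 1] entry[of 2 2] by (intro mult_mono) linarith+
  moreover have "\<bar>q\<bar> \<le> B * D"
    unfolding q_def abs_mult using entry[of 1 2] entry[of 2 1] by (intro mult_mono) linarith+
  moreover have "\<bar>r\<bar> \<le> D * B"
    unfolding r_def abs_mult using entry[of 1 2] entry[of 2 1] by (intro mult_mono) linarith+
  moreover have "discr A - discr A' = p + 4 * (q + r)"
    by (simp add: p_def q_def r_def discr_2 power2_eq_square algebra_simps)
  ultimately show ?thesis unfolding D_def[symmetric] by (simp add: algebra_simps)
qed

text \<open>
  This transfers the summability of \<open>R\<^bsub>n+1\<^esub> - R\<^sub>n\<close> to the eigenvector matrices: away from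
  discriminant zero the eigenvalues, and with them the eigenvectors, are Lipschitz functions of
  the matrix on bounded sets.
\<close>

lemma eigbasis_lipschitz:
  assumes "\<tau> \<in> {-1, 1}" "0 < \<delta>" "\<delta> \<le> \<tau> * discr A" "\<delta> \<le> \<tau> * discr A'"
    and "norm A \<le> B" "norm A' \<le> B" and \<epsilon>: "\<bar>\<epsilon>\<bar> = 1"
  shows "norm (eigbasis \<epsilon> c A - eigbasis \<epsilon> c A') \<le>
           (8 + 32 * B / sqrt \<delta>) * norm c * norm (A - A')"
proof -
  define D where "D = norm (A - A')"
  have "norm (discr_root A - discr_root A') \<le> \<bar>discr A - discr A'\<bar> / sqrt \<delta>"
    unfolding discr_root_def by (rule csqrt_of_real_lipschitz[OF assms(1-4)])
  also have "\<dots> \<le> 16 * B * D / sqrt \<delta>"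
    using discr_lipschitz[OF assms(5,6)] assms(2) unfolding D_def
    by (intro divide_right_mono) auto
  finally have root: "norm (discr_root A - discr_root A') \<le> 16 * B * D / sqrt \<delta>" .
  have trace: "\<bar>trace A - trace A'\<bar> \<le> 2 * D"
    using norm_matrix_entry_le[of "A - A'" 1 1] norm_matrix_entry_le[of "A - A'" 2 2]
    by (simp add: trace_2 D_def)
  have eig: "norm (eigval e A - eigval e A') \<le> (1 + 8 * B / sqrt \<delta>) * D" if "\<bar>e\<bar> = 1" for e
  proof -
    have "eigval e A - eigval e A' =
        (complex_of_real (trace A - trace A') + complex_of_real e * (discr_root A - discr_root A')) / 2"
      by (simp add: eigval_def field_simps)
    also have "norm \<dots> \<le> (\<bar>trace A - trace A'\<bar> + norm (discr_root A - discr_root A')) / 2"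
      using norm_triangle_ineq[of "complex_of_real (trace A - trace A')"
          "complex_of_real e * (discr_root A - discr_root A')"] that
      unfolding norm_divide norm_mult norm_of_real by simp
    also have "\<dots> \<le> (2 * D + 16 * B * D / sqrt \<delta>) / 2"
      using root trace by simp
    also have "\<dots> = (1 + 8 * B / sqrt \<delta>) * D" by (simp add: field_simps)
    finally show ?thesis .
  qed
  have entry: "norm ((eigbasis \<epsilon> c A - eigbasis \<epsilon> c A') $ i $ j)
      \<le> (2 + 8 * B / sqrt \<delta>) * norm c * D" for i j
  proof -
    let ?e = "if j = 1 then - \<epsilon> else \<epsilon>"
    have "(eigbasis \<epsilon> c A - eigbasis \<epsilon> c A') $ i $ j
        = (cmat (A - A') *v c) $ i - (eigval ?e A - eigval ?e A') * c $ i"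
      by (simp add: eigbasis_def matrix_vector_mult_2 algebra_simps)
    also have "norm \<dots> \<le> norm ((cmat (A - A') *v c) $ i) + norm ((eigval ?e A - eigval ?e A') * c $ i)"
      by (rule norm_triangle_ineq4)
    also have "\<dots> \<le> D * norm c + (1 + 8 * B / sqrt \<delta>) * D * norm c"
    proof (rule add_mono)
      show "norm ((cmat (A - A') *v c) $ i) \<le> D * norm c"
        using norm_matrix_vector_mult_le[of "cmat (A - A')" c]
        by (intro order_trans[OF Finite_Cartesian_Product.norm_nth_le]) (simp add: norm_cmat D_def)
      show "norm ((eigval ?e A - eigval ?e A') * c $ i) \<le> (1 + 8 * B / sqrt \<delta>) * D * norm c"
        unfolding norm_mult
        using eig[of ?e] \<epsilon> order_trans[OF norm_ge_zero eig[of ?e]]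
        by (intro mult_mono Finite_Cartesian_Product.norm_nth_le) auto
    qed
    also have "\<dots> = (2 + 8 * B / sqrt \<delta>) * norm c * D" by (simp add: algebra_simps)
    finally show ?thesis .
  qed
  have "norm (eigbasis \<epsilon> c A - eigbasis \<epsilon> c A')
      \<le> (\<Sum>i\<in>(UNIV::2 set). \<Sum>j\<in>(UNIV::2 set). (2 + 8 * B / sqrt \<delta>) * norm c * D)"
    by (intro order_trans[OF norm_vec_le_sum] sum_mono entry)
  then show ?thesis by (simp add: D_def algebra_simps)
qed

lemma eigval_cnj:
  assumes "discr A < 0"
  shows "eigval (- \<epsilon>) A = cnj (eigval \<epsilon> A)"
  using assms by (simp add: eigval_def discr_root_def csqrt_of_real')

lemma eigval_real:
  assumes "discr A > 0"
  shows "eigval \<epsilon> A = complex_of_real ((trace A + \<epsilon> * sqrt (discr A)) / 2)"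
  using assms by (simp add: eigval_def discr_root_def csqrt_of_real')

text \<open>
  The normalized quantity \<open>(2 \<eta> - tr) / \<surd>discr\<close> is continuous and takes only the values \<open>1\<close> and
  \<open>-1\<close>, so it is constant on a connected set.
\<close>

lemma continuous_eigenvalue_branch:
  fixes F :: "'x::topological_space \<Rightarrow> real^2^2"
  assumes "connected K" "continuous_on K F" "continuous_on K \<eta>"
    and nz: "\<And>x. x \<in> K \<Longrightarrow> discr (F x) \<noteq> 0"
    and eig: "\<And>x. x \<in> K \<Longrightarrow> eigenvalue (cmat (F x)) (\<eta> x)"
  shows "\<exists>\<epsilon>\<in>{-1, 1}. \<forall>x\<in>K. \<eta> x = eigval \<epsilon> (F x)"
proof -
  define w where "w x = (2 * \<eta> x - complex_of_real (trace (F x))) / discr_root (F x)" for x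
  have cont: "continuous_on K w"
  proof -
    have "continuous_on K (\<lambda>x. discr_root (F x))"
      using continuous_on_compose2[OF continuous_on_discr_root assms(2)] by simp
    then show ?thesis
      unfolding w_def trace_2 using assms(2,3) nz by (intro continuous_intros) auto
  qed
  have w: "w x = 1 \<and> \<eta> x = eigval 1 (F x) \<or> w x = - 1 \<and> \<eta> x = eigval (-1) (F x)" if "x \<in> K" for x
  proof -
    have r: "discr_root (F x) \<noteq> 0" using nz[OF that] by simp
    from eigenvalue_cmat_cases[OF eig[OF that]] show ?thesis
    proof
      assume "\<eta> x = eigval 1 (F x)"
      moreover from this have "2 * \<eta> x - complex_of_real (trace (F x)) = discr_root (F x)"
        by (simp add: eigval_def algebra_simps)
      ultimately show ?thesis using r by (simp add: w_def)
    next
      assume "\<eta> x = eigval (-1) (F x)"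
      moreover from this have "2 * \<eta> x - complex_of_real (trace (F x)) = - discr_root (F x)"
        by (simp add: eigval_def algebra_simps)
      ultimately show ?thesis using r by (simp add: w_def)
    qed
  qed
  have "finite (w ` K)"
    using w by (intro finite_subset[of "w ` K" "{1, -1}"]) auto
  then obtain z where z: "\<And>x. x \<in> K \<Longrightarrow> w x = z"
    using connected_finite_iff_sing[OF connected_continuous_image[OF cont assms(1)]] by fastforce
  show ?thesis
  proof (cases "z = 1")
    case True
    then show ?thesis using w z by (intro bexI[of _ 1]) fastforce+
  next
    case False
    then show ?thesis using w z by (intro bexI[of _ "-1"]) fastforce+
  qed
qed

lemma connected_nonzero_sign:
  fixes f :: "'x::topological_space \<Rightarrow> real"
  assumes "connected K" "continuous_on K f" "\<And>x. x \<in> K \<Longrightarrow> f x \<noteq> 0"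
  shows "(\<forall>x\<in>K. f x > 0) \<or> (\<forall>x\<in>K. f x < 0)"
proof (rule ccontr)
  assume "\<not> ?thesis"
  then obtain x y where "x \<in> K" "y \<in> K" "f x \<le> 0" "f y \<ge> 0" by (auto simp: not_less)
  then have "0 \<in> f ` K"
    using connectedD_interval[OF connected_continuous_image[OF assms(2,1)], of "f x" "f y" 0] by auto
  then show False using assms(3) by auto
qed

section \<open>Conjugation to a nearly diagonal system\<close>

lemma continuous_on_matrix_mult:
  fixes A :: "'x::topological_space \<Rightarrow> 'a::real_normed_algebra_1^'n^'m"
    and B :: "'x \<Rightarrow> 'a^'p^'n"
  assumes "continuous_on K A" "continuous_on K B"
  shows "continuous_on K (\<lambda>x. A x ** B x)"
  unfolding matrix_matrix_mult_def
  using assms by (intro continuous_on_vec_lambda continuous_on_sum continuous_on_mult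
      continuous_on_component)

lemma continuous_on_diag2:
  fixes p q :: "'x::topological_space \<Rightarrow> 'a::real_normed_vector"
  assumes "continuous_on K p" "continuous_on K q"
  shows "continuous_on K (\<lambda>x. diag2 (p x) (q x))"
proof -
  have "continuous_on K (\<lambda>x. if i = j then (if i = 1 then p x else q x) else 0)" for i j :: 2
    using assms by (cases "i = j"; cases "i = 1") auto
  then show ?thesis unfolding diag2_def by (intro continuous_on_vec_lambda)
qed

lemma norm_inverse2_le:
  fixes A :: "'a::real_normed_field^2^2"
  shows "norm (inverse2 A) \<le> 4 * norm A / norm (det A)"
proof -
  have "norm (inverse2 A $ i $ j) \<le> norm A / norm (det A)" for i j
    by (auto simp: inverse2_def norm_divide intro!: divide_right_mono norm_matrix_entry_le)
  then have "norm (inverse2 A) \<le> (\<Sum>i\<in>(UNIV::2 set). \<Sum>j\<in>(UNIV::2 set). norm A / norm (det A))"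
    by (intro order_trans[OF norm_vec_le_sum] sum_mono)
  then show ?thesis by simp
qed

text \<open>
  With \<open>\<Lambda> = diag (1, d'/d)\<close> and \<open>S\<close> the inverse of \<open>T'\<close>, the step matrix in the moving eigenbasis,
  divided by \<open>d\<close>, is \<open>S (A + E) T / d = \<Lambda> - S (T' - T) \<Lambda> + S E T / d\<close>. Both error terms are small
  as soon as the eigenbasis varies slowly and \<open>E\<close> is small.
\<close>

lemma conjugated_step_estimate:
  fixes A E T T' :: "'a::real_normed_field^2^2"
  assumes diag: "\<And>u. A *v (T *v u) = T *v (diag2 d d' *v u)"
    and det: "det T' \<noteq> 0"
    and T: "norm T \<le> BT" and T': "norm (inverse2 T') \<le> BS"
    and diff: "norm (T' - T) \<le> t" and E: "norm E \<le> e"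
    and d: "1 / 2 \<le> norm d" "norm d' \<le> 2"
  shows "norm (inverse2 T' *v ((A + E) *v (T *v (inverse d *s u))) - diag2 1 (d' / d) *v u)
           \<le> BS * (4 * t + 2 * BT * e) * norm u"
proof -
  define w where "w = diag2 1 (d' / d) *v u"
  have d0: "d \<noteq> 0" using d(1) by auto
  have w: "diag2 d d' *v (inverse d *s u) = w"
    using d0 by (simp add: w_def vec_eq_iff forall_2 diag2_mult_component divide_inverse)
  have "(A + E) *v (T *v (inverse d *s u)) = T *v w + E *v (T *v (inverse d *s u))"
    by (simp only: matrix_vector_mult_add_rdistrib diag w)
  also have "\<dots> = T' *v w - ((T' - T) *v w - E *v (T *v (inverse d *s u)))"
    by (simp add: matrix_vector_mult_diff_rdistrib)
  finally have "inverse2 T' *v ((A + E) *v (T *v (inverse d *s u))) - w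
      = - (inverse2 T' *v ((T' - T) *v w - E *v (T *v (inverse d *s u))))"
    by (simp only: matrix_vector_mult_diff_distrib[of "inverse2 T'" "T' *v w"] inverse2_mult(2)[OF det])
       simp
  also have "norm \<dots> \<le> norm (inverse2 T') * norm ((T' - T) *v w - E *v (T *v (inverse d *s u)))"
    unfolding norm_minus_cancel by (rule norm_matrix_vector_mult_le)
  also have "\<dots> \<le> BS * (t * (4 * norm u) + e * (BT * (2 * norm u)))"
  proof (intro mult_mono T' order_trans[OF norm_triangle_ineq4] add_mono)
    have "norm (w $ i) \<le> norm ((4 *\<^sub>R u) $ i)" for i
    proof -
      have "norm d' / norm d \<le> 2 / (1 / 2)" using d by (intro frac_le) auto
      then have "norm (if i = 1 then 1 else d' / d) \<le> 4" by (simp add: norm_divide)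
      then show ?thesis
        by (simp add: w_def diag2_mult_component norm_mult mult_right_mono del: if_image_distrib)
    qed
    then have w4: "norm w \<le> 4 * norm u" using norm_le_componentwise_cart[of w "4 *\<^sub>R u"] by simp
    have t0: "0 \<le> t" using diff norm_ge_zero order_trans by blast
    have e0: "0 \<le> e" using E norm_ge_zero order_trans by blast
    have b0: "0 \<le> BT" using T norm_ge_zero order_trans by blast
    show "0 \<le> BS" using T' norm_ge_zero order_trans by blast
    show "norm ((T' - T) *v w) \<le> t * (4 * norm u)"
      using diff w4 t0 by (intro order_trans[OF norm_matrix_vector_mult_le] mult_mono) auto
    have "norm ((inverse d *s u) $ i) \<le> norm ((2 *\<^sub>R u) $ i)" for i
    proof -
      have "inverse (norm d) \<le> inverse (1 / 2)" using d(1) by (intro le_imp_inverse_le) auto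
      then have "norm (inverse d) \<le> 2" by (simp add: norm_inverse)
      then show ?thesis by (simp add: norm_mult mult_right_mono)
    qed
    then have "norm (inverse d *s u) \<le> 2 * norm u"
      using norm_le_componentwise_cart[of "inverse d *s u" "2 *\<^sub>R u"] by simp
    then have "norm (T *v (inverse d *s u)) \<le> BT * (2 * norm u)"
      using T b0 by (intro order_trans[OF norm_matrix_vector_mult_le] mult_mono) auto
    then show "norm (E *v (T *v (inverse d *s u))) \<le> e * (BT * (2 * norm u))"
      by (rule order_trans[OF norm_matrix_vector_mult_le mult_mono[OF E _ e0 norm_ge_zero]])
  qed simp
  also have "\<dots> = BS * (4 * t + 2 * BT * e) * norm u" by (simp add: algebra_simps)
  finally show ?thesis by (simp only: w_def)
qed

text \<open>
  The substitution \<open>\<Phi>\<^sub>n = (\<Prod>j<n. d\<^sub>j) T\<^sub>n \<psi>\<^sub>n\<close> turns the given system into one for \<open>\<psi>\<close> that differs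
  from \<open>diag (1, d'\<^sub>n/d\<^sub>n)\<close> by summable terms. The hypothesis named \<open>dichotomy\<close> says that the modulus
  of \<open>d'\<^sub>n\<close> either dominates that of \<open>d\<^sub>n\<close> or is smaller by factors with divergent total rate, which
  are the situations of the two preceding results on nearly diagonal systems.
\<close>

lemma levinson_diagonalizable:
  fixes A E T :: "nat \<Rightarrow> 'x::topological_space \<Rightarrow> 'a::{real_normed_field,banach}^2^2"
  assumes K: "compact K"
    and cont: "\<And>n. n \<ge> N \<Longrightarrow> continuous_on K (A n)" "\<And>n. n \<ge> N \<Longrightarrow> continuous_on K (E n)"
      "\<And>n. n \<ge> N \<Longrightarrow> continuous_on K (T n)" "\<And>n. n \<ge> N \<Longrightarrow> continuous_on K (d n)"
    and diag: "\<And>n x u. n \<ge> N \<Longrightarrow> x \<in> K \<Longrightarrow>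
                 A n x *v (T n x *v u) = T n x *v (diag2 (d n x) (d' n x) *v u)"
    and T: "\<And>n x. n \<ge> N \<Longrightarrow> x \<in> K \<Longrightarrow> det (T n x) \<noteq> 0"
      "\<And>n x. n \<ge> N \<Longrightarrow> x \<in> K \<Longrightarrow> norm (T n x) \<le> BT"
      "\<And>n x. n \<ge> N \<Longrightarrow> x \<in> K \<Longrightarrow> norm (inverse2 (T n x)) \<le> BS"
      "\<And>n x. n \<ge> N \<Longrightarrow> x \<in> K \<Longrightarrow> norm (T (Suc n) x - T n x) \<le> t n"
    and t: "summable t" "\<And>n. 0 \<le> t n"
    and E: "\<And>n x. n \<ge> N \<Longrightarrow> x \<in> K \<Longrightarrow> norm (E n x) \<le> e n"
    and e: "summable e" "\<And>n. 0 \<le> e n"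
    and d: "\<And>n x. n \<ge> N \<Longrightarrow> x \<in> K \<Longrightarrow> 1 / 2 \<le> norm (d n x)"
      "\<And>n x. n \<ge> N \<Longrightarrow> x \<in> K \<Longrightarrow> norm (d' n x) \<le> 2"
    and dichotomy: "(\<forall>n\<ge>N. \<forall>x\<in>K. norm (d n x) \<le> norm (d' n x)) \<or>
      (\<exists>\<kappa>. (\<forall>n\<ge>N. 0 \<le> \<kappa> n \<and> \<kappa> n \<le> 1 \<and> (\<forall>x\<in>K. norm (d' n x) \<le> (1 - \<kappa> n) * norm (d n x))) \<and>
           filterlim (\<lambda>m. \<Sum>n<m. \<kappa> n) at_top sequentially)"
    and T_lim: "continuous_on K T\<^sub>0" "uniform_limit K T T\<^sub>0 sequentially"
    and nonneg: "0 \<le> BT" "0 \<le> BS"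
  shows "\<exists>n0\<ge>N. \<exists>\<Phi> L. (\<forall>n\<ge>n0. continuous_on K (\<Phi> n)) \<and> continuous_on K L \<and>
           (\<forall>x\<in>K. L x \<noteq> 0) \<and>
           (\<forall>n\<ge>n0. \<forall>x\<in>K. \<Phi> (Suc n) x = (A n x + E n x) *v \<Phi> n x) \<and>
           uniform_limit K (\<lambda>n x. inverse (\<Prod>j=n0..<n. d j x) *s \<Phi> n x)
             (\<lambda>x. T\<^sub>0 x *v (L x *s axis 1 1)) sequentially"
proof -
  define M where "M n x = inverse2 (T (Suc n) x) **
      ((A n x + E n x) ** (T n x ** diag2 (inverse (d n x)) (inverse (d n x))))" for n x
  define q where "q n x = d' n x / d n x" for n x
  define g where "g n = BS * (4 * t n + 2 * BT * e n)" for n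
  have M: "M n x *v u = inverse2 (T (Suc n) x) *v ((A n x + E n x) *v (T n x *v (inverse (d n x) *s u)))"
    for n x u
  proof -
    have "diag2 (inverse (d n x)) (inverse (d n x)) *v u = inverse (d n x) *s u"
      by (simp add: vec_eq_iff diag2_mult_component)
    then show ?thesis by (simp add: M_def flip: matrix_vector_mul_assoc)
  qed
  have d_nz: "d n x \<noteq> 0" if "n \<ge> N" "x \<in> K" for n x
    using d(1)[OF that] by auto
  have M_cont: "continuous_on K (M n)" if "n \<ge> N" for n
    unfolding M_def using that cont T(1) d_nz
    by (intro continuous_on_matrix_mult continuous_on_diag2 continuous_on_inverse2 continuous_on_add
        continuous_on_inverse) auto
  have close: "norm (M n x *v u - diag2 1 (q n x) *v u) \<le> g n * norm u"
    if "n \<ge> N" "x \<in> K" for n x u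
    unfolding M q_def g_def using that
    by (intro conjugated_step_estimate diag T E d) auto
  have g: "summable g" "\<And>n. 0 \<le> g n"
    unfolding g_def using t e nonneg
    by (auto intro!: summable_mult summable_add mult_nonneg_nonneg add_nonneg_nonneg)
  have "\<exists>n0\<ge>N. \<exists>\<psi> L. (\<forall>n\<ge>n0. continuous_on K (\<psi> n)) \<and> continuous_on K L \<and>
           (\<forall>x\<in>K. L x \<noteq> 0) \<and>
           (\<forall>n\<ge>n0. \<forall>x\<in>K. \<psi> (Suc n) x = M n x *v \<psi> n x) \<and>
           uniform_limit K \<psi> (\<lambda>x. L x *s axis 1 1) sequentially"
    using dichotomy
  proof (elim disjE exE conjE)
    assume ge: "\<forall>n\<ge>N. \<forall>x\<in>K. norm (d n x) \<le> norm (d' n x)"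
    have q: "1 \<le> norm (q n x)" if "n \<ge> N" "x \<in> K" for n x
      using ge that d_nz[OF that] by (simp add: q_def norm_divide le_divide_eq)
    obtain n0 \<psi> where "n0 \<ge> N" and \<psi>: "\<forall>n\<ge>n0. continuous_on K (\<psi> n)"
        "\<forall>n\<ge>n0. \<forall>x\<in>K. \<psi> (Suc n) x = M n x *v \<psi> n x"
        "uniform_limit K \<psi> (\<lambda>x. axis 1 1) sequentially"
      using levinson_nondecaying[OF M_cont close g q] by blast
    then show ?thesis
      by (intro exI[of _ n0] exI[of _ \<psi>] exI[of _ "\<lambda>_. 1"] conjI) auto
  next
    fix \<kappa>
    assume \<kappa>: "\<forall>n\<ge>N. 0 \<le> \<kappa> n \<and> \<kappa> n \<le> 1 \<and> (\<forall>x\<in>K. norm (d' n x) \<le> (1 - \<kappa> n) * norm (d n x))"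
      and div: "filterlim (\<lambda>m. \<Sum>n<m. \<kappa> n) at_top sequentially"
    have q: "norm (q n x) \<le> 1 - \<kappa> n" if "n \<ge> N" "x \<in> K" for n x
      using \<kappa> that d_nz[OF that] by (simp add: q_def norm_divide divide_le_eq)
    show ?thesis
      by (rule levinson_decaying[OF M_cont close g q _ _ div]) (use \<kappa> in auto)
  qed
  then obtain n0 \<psi> L where n0: "n0 \<ge> N"
    and \<psi>_cont: "\<And>n. n \<ge> n0 \<Longrightarrow> continuous_on K (\<psi> n)"
    and L: "continuous_on K L" "\<forall>x\<in>K. L x \<noteq> 0"
    and \<psi>_rec: "\<And>n x. n \<ge> n0 \<Longrightarrow> x \<in> K \<Longrightarrow> \<psi> (Suc n) x = M n x *v \<psi> n x"
    and \<psi>_lim: "uniform_limit K \<psi> (\<lambda>x. L x *s axis 1 1) sequentially"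
    by blast
  define p where "p n x = (\<Prod>j=n0..<n. d j x)" for n x
  define \<Phi> where "\<Phi> n x = T n x *v (p n x *s \<psi> n x)" for n x
  have p_nz: "p n x \<noteq> 0" if "x \<in> K" for n x
    using d_nz n0 that by (auto simp: p_def)
  have p_cont: "continuous_on K (p n)" for n
    unfolding p_def using n0 cont(4) by (intro continuous_on_prod) auto
  have scaled_cont: "continuous_on K (\<lambda>x. f x *s h x)"
    if "continuous_on K f" "continuous_on K h" for f and h :: "'x \<Rightarrow> 'a^2"
    unfolding vector_scalar_mult_def using that
    by (intro continuous_on_vec_lambda continuous_on_mult continuous_on_component)
  have \<Phi>_cont: "continuous_on K (\<Phi> n)" if "n \<ge> n0" for n
    unfolding \<Phi>_def using that n0
    by (intro continuous_on_matrix_vector_mult scaled_cont cont p_cont \<psi>_cont) auto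
  have \<Phi>_rec: "\<Phi> (Suc n) x = (A n x + E n x) *v \<Phi> n x" if "n \<ge> n0" "x \<in> K" for n x
  proof -
    have nN: "n \<ge> N" "Suc n \<ge> N" using that n0 by auto
    have "p (Suc n) x = p n x * d n x" using that by (simp add: p_def)
    then have "\<Phi> (Suc n) x = (p n x * d n x) *s (T (Suc n) x *v (M n x *v \<psi> n x))"
      using \<psi>_rec[OF that] by (simp add: \<Phi>_def vector_scalar_commute)
    also have "T (Suc n) x *v (M n x *v \<psi> n x)
        = inverse (d n x) *s ((A n x + E n x) *v (T n x *v \<psi> n x))"
      by (simp add: M inverse2_mult(1)[OF T(1)[OF nN(2) that(2)]] vector_scalar_commute)
    also have "(p n x * d n x) *s \<dots> = (A n x + E n x) *v \<Phi> n x"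
      using d_nz[OF nN(1) that(2)] by (simp add: \<Phi>_def vector_scalar_commute)
    finally show ?thesis .
  qed
  have bounded: "bounded (T\<^sub>0 ` K)" "bounded ((\<lambda>x. L x *s axis 1 1 :: 'a^2) ` K)"
    using K T_lim(1) L(1)
    by (intro compact_imp_bounded compact_continuous_image scaled_cont; simp)+
  have "uniform_limit K (\<lambda>n x. T n x *v \<psi> n x) (\<lambda>x. T\<^sub>0 x *v (L x *s axis 1 1)) sequentially"
    by (rule bounded_bilinear.bounded_uniform_limit[OF bounded_bilinear_matrix_vector_mult
          T_lim(2) \<psi>_lim bounded(2,1)])
  moreover have "inverse (p n x) *s \<Phi> n x = T n x *v \<psi> n x" if "x \<in> K" for n x
    using p_nz[OF that] by (simp add: \<Phi>_def vector_scalar_commute)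
  ultimately have "uniform_limit K (\<lambda>n x. inverse (p n x) *s \<Phi> n x)
      (\<lambda>x. T\<^sub>0 x *v (L x *s axis 1 1)) sequentially"
    by (simp add: uniform_limit_iff)
  then show ?thesis
    unfolding p_def using n0 \<Phi>_cont L \<Phi>_rec
    by (intro exI[of _ n0] exI[of _ \<Phi>] exI[of _ L] conjI allI impI ballI) auto
qed

section \<open>Moduli of the eigenvalues of the one-step matrices\<close>

text \<open>
  The two numbers are complex conjugates, so for negative discriminant neither of the two
  solutions dominates the other.
\<close>

lemma norm_shifted_eigval_neg:
  assumes "discr A < 0"
  shows "norm (complex_of_real s + complex_of_real g * eigval (- \<epsilon>) A)
       = norm (complex_of_real s + complex_of_real g * eigval \<epsilon> A)"
proof -
  have "complex_of_real s + complex_of_real g * eigval (- \<epsilon>) A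
      = cnj (complex_of_real s + complex_of_real g * eigval \<epsilon> A)"
    by (simp add: eigval_cnj[OF assms])
  then show ?thesis by (simp only: complex_mod_cnj)
qed

text \<open>
  Since the real numbers \<open>\<sigma> + g \<mu>\<close> and \<open>\<sigma> + g \<nu>\<close> both have the sign of \<open>\<sigma>\<close>, the difference of their
  moduli is \<open>\<sigma> g (\<mu> - \<nu>)\<close>. For positive \<open>g\<close> its sign is that of \<open>\<sigma> \<epsilon>\<close>, and it is
  proportional to \<open>g\<close>, which is why the divergence of \<open>\<Sum>1/\<gamma>\<^sub>n\<close> matters for real eigenvalues.
\<close>

lemma norm_shifted_eigval_diff_pos:
  assumes "discr A > 0" "\<sigma> \<in> {-1, 1}"
    and small: "norm (complex_of_real g * eigval \<epsilon> A) \<le> 1 / 2"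
      "norm (complex_of_real g * eigval (- \<epsilon>) A) \<le> 1 / 2"
  shows "norm (complex_of_real \<sigma> + complex_of_real g * eigval \<epsilon> A)
         - norm (complex_of_real \<sigma> + complex_of_real g * eigval (- \<epsilon>) A)
       = \<sigma> * \<epsilon> * g * sqrt (discr A)"
proof -
  have one: "norm (complex_of_real \<sigma> + complex_of_real g * eigval e A)
      = 1 + \<sigma> * (g * ((trace A + e * sqrt (discr A)) / 2))"
    if "norm (complex_of_real g * eigval e A) \<le> 1 / 2" for e
  proof -
    define y where "y = g * ((trace A + e * sqrt (discr A)) / 2)"
    have y: "complex_of_real g * eigval e A = complex_of_real y"
      by (simp add: y_def eigval_real[OF assms(1)])
    have "\<bar>y\<bar> \<le> 1 / 2" using that by (simp only: y norm_of_real)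
    moreover have "norm (complex_of_real \<sigma> + complex_of_real y) = \<bar>\<sigma> + y\<bar>"
      by (simp only: norm_of_real flip: of_real_add)
    ultimately show ?thesis using assms(2) unfolding y y_def[symmetric] by auto
  qed
  show ?thesis unfolding one[OF small(1)] one[OF small(2)] by (simp add: field_simps)
qed

section \<open>Asymptotics of a distinguished solution\<close>

theorem theorem4p4:
  fixes a b \<sigma> :: real
    and K :: "real set"
    and X R :: "nat \<Rightarrow> real \<Rightarrow> real^2^2"
    and \<R> :: "real \<Rightarrow> real^2^2"
    and \<gamma> :: "nat \<Rightarrow> real"
    and E :: "nat \<Rightarrow> real \<Rightarrow> complex^2^2"
    and \<eta> :: "real \<Rightarrow> complex"
  assumes K: "K = {a..b}" "a \<le> b"
    and X_cont: "\<And>n. n \<ge> 1 \<Longrightarrow> continuous_on UNIV (X n)"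
    and X_GL: "\<And>n x. n \<ge> 1 \<Longrightarrow> invertible (X n x)"
    and \<sigma>: "\<sigma> \<in> {-1, 1}"
    and X_lim: "uniform_limit K X (\<lambda>x. \<sigma> *\<^sub>R mat 1) sequentially"
    and \<gamma>_pos: "\<And>n. \<gamma> n > 0"
    and R: "\<And>n x. n \<ge> 1 \<Longrightarrow> R n x = \<gamma> n *\<^sub>R (X n x - \<sigma> *\<^sub>R mat 1)"
    and R_lim: "uniform_limit K R \<R> sequentially"
    and discr_nz: "\<And>x. x \<in> K \<Longrightarrow> discr (\<R> x) \<noteq> 0"
    and \<gamma>_div: "(\<forall>x\<in>K. discr (\<R> x) > 0) \<Longrightarrow>
                   filterlim (\<lambda>N. \<Sum>n<N. 1 / \<gamma> n) at_top sequentially"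
    and E_cont: "\<And>n. n \<ge> 1 \<Longrightarrow> continuous_on UNIV (E n)"
    and E_sum: "summable (\<lambda>n. sup_opnorm K (E (Suc n)))"
    and R_D10: "D10_on K R"
    and \<eta>_cont: "continuous_on K \<eta>"
    and \<eta>_eig: "\<And>x. x \<in> K \<Longrightarrow> eigenvalue (cmat (\<R> x)) (\<eta> x)"
  shows "\<exists>n0\<ge>1. \<exists>(\<Phi> :: nat \<Rightarrow> real \<Rightarrow> complex^2) (\<mu> :: nat \<Rightarrow> real \<Rightarrow> complex) (v :: real \<Rightarrow> complex^2).
           (\<forall>n\<ge>n0. continuous_on K (\<Phi> n)) \<and>
           (\<forall>n\<ge>n0. continuous_on K (\<mu> n)) \<and>
           continuous_on K v \<and>
           (\<forall>n\<ge>n0. \<forall>x\<in>K. \<Phi> (n + 1) x = (cmat (X n x) + E n x) *v \<Phi> n x) \<and>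
           (\<lambda>n. SUP x\<in>K. norm
              (inverse (\<Prod>j=n0..<n. complex_of_real \<sigma> + complex_of_real (inverse (\<gamma> j)) * \<mu> j x) *s \<Phi> n x
               - v x)) \<longlonglongrightarrow> 0 \<and>
           (\<forall>x\<in>K. eigenvector (cmat (\<R> x)) (v x) (\<eta> x)) \<and>
           (\<forall>n\<ge>n0. \<forall>x\<in>K. eigenvalue (cmat (R n x)) (\<mu> n x)) \<and>
           (\<lambda>n. SUP x\<in>K. norm (\<mu> n x - \<eta> x)) \<longlonglongrightarrow> 0"
proof -
  have comp: "compact K" and conn: "connected K" and ne: "K \<noteq> {}" and aK: "a \<in> K"
    using K by auto
  have R_cont: "continuous_on K (R n)" if "n \<ge> 1" for n
    using R_D10 that by (simp add: D10_on_def D10_def)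
  have \<R>_cont: "continuous_on K \<R>"
  proof (rule uniform_limit_theorem[OF _ R_lim])
    show "\<forall>\<^sub>F n in sequentially. continuous_on K (R n)"
      using eventually_ge_at_top[of 1] by eventually_elim (rule R_cont)
  qed simp
  note lim = uniform_limit_compose_continuous[OF comp \<R>_cont R_lim]

  obtain \<epsilon> where \<epsilon>: "\<epsilon> \<in> {-1, 1 :: real}" and \<eta>: "\<And>x. x \<in> K \<Longrightarrow> \<eta> x = eigval \<epsilon> (\<R> x)"
    using continuous_eigenvalue_branch[OF conn \<R>_cont \<eta>_cont discr_nz \<eta>_eig] by auto
  have \<epsilon>': "\<epsilon>\<^sup>2 = 1" "\<bar>\<epsilon>\<bar> = 1" "\<epsilon> \<noteq> 0" using \<epsilon> by auto

  have "(\<forall>x\<in>K. discr (\<R> x) > 0) \<or> (\<forall>x\<in>K. discr (\<R> x) < 0)"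
    using continuous_on_compose2[OF continuous_on_discr \<R>_cont] discr_nz
    by (intro connected_nonzero_sign[OF conn]) auto
  then obtain \<tau> where \<tau>: "\<tau> \<in> {-1, 1 :: real}" "\<And>x. x \<in> K \<Longrightarrow> \<tau> * discr (\<R> x) > 0"
  proof
    assume "\<forall>x\<in>K. discr (\<R> x) > 0" then show ?thesis by (intro that[of 1]) auto
  next
    assume "\<forall>x\<in>K. discr (\<R> x) < 0" then show ?thesis by (intro that[of "-1"]) auto
  qed
  \<comment> \<open>A vector that is an eigenvector of no real matrix whose discriminant has sign \<open>\<tau>\<close>.\<close>
  define c :: "complex^2" where "c = (if \<tau> = 1 then vector [1, \<i>] else vector [1, 0])"
  have det_nz: "det (eigbasis \<epsilon> c A) \<noteq> 0" if "\<tau> * discr A > 0" for A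
    using \<tau>(1) that det_eigbasis_nonzero_pos[OF \<epsilon>'(3), of A]
      det_eigbasis_nonzero_neg[OF \<epsilon>'(3), of A] by (auto simp: c_def)

  have det_cont: "continuous_on UNIV (\<lambda>A. norm (det (eigbasis \<epsilon> c A)))"
    by (intro continuous_on_norm continuous_on_det2 continuous_on_eigbasis)
  have discr_cont: "continuous_on UNIV (\<lambda>A. \<tau> * discr A)"
    by (intro continuous_intros continuous_on_discr)
  have on_K: "continuous_on K (\<lambda>x. f (\<R> x))" if "continuous_on UNIV f"
    for f :: "real^2^2 \<Rightarrow> 'z::metric_space"
    using continuous_on_compose2[OF that \<R>_cont] by simp

  obtain \<delta> where \<delta>: "\<delta> > 0" "\<forall>\<^sub>F n in sequentially. \<forall>x\<in>K. \<delta> \<le> \<tau> * discr (R n x)"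
    using uniform_limit_eventually_ge_pos[OF comp on_K[OF discr_cont] lim[OF discr_cont] \<tau>(2)] by auto
  obtain \<delta>' where \<delta>': "\<delta>' > 0"
      "\<forall>\<^sub>F n in sequentially. \<forall>x\<in>K. \<delta>' \<le> norm (det (eigbasis \<epsilon> c (R n x)))"
    using uniform_limit_eventually_ge_pos[OF comp on_K[OF det_cont] lim[OF det_cont]] det_nz \<tau>(2)
    by auto
  obtain B where B: "B > 0" "\<forall>\<^sub>F n in sequentially. \<forall>x\<in>K. norm (R n x) \<le> B"
    using uniform_limit_eventually_bounded[OF comp \<R>_cont R_lim] by auto
  note T_cont = continuous_on_eigbasis[of \<epsilon> c]
  obtain BT where BT: "BT > 0" "\<forall>\<^sub>F n in sequentially. \<forall>x\<in>K. norm (eigbasis \<epsilon> c (R n x)) \<le> BT"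
    using uniform_limit_eventually_bounded[OF comp on_K[OF T_cont] lim[OF T_cont]] by auto

  \<comment> \<open>\<open>X\<^sub>n - \<sigma> Id = R\<^sub>n / \<gamma>\<^sub>n\<close> tends to zero although \<open>R\<^sub>n\<close> does not: a matrix with nonzero
    discriminant is not zero. One point of \<open>K\<close> suffices.\<close>
  have \<gamma>_lim: "(\<lambda>n. inverse (\<gamma> n)) \<longlonglongrightarrow> 0"
  proof -
    have "(\<lambda>n. norm (X n a - \<sigma> *\<^sub>R mat 1)) \<longlonglongrightarrow> 0"
      using tendsto_uniform_limitI[OF X_lim aK] by (simp add: LIM_zero tendsto_norm_zero)
    moreover have R_a: "(\<lambda>n. norm (R n a)) \<longlonglongrightarrow> norm (\<R> a)"
      by (intro tendsto_norm tendsto_uniform_limitI[OF R_lim aK])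
    moreover have "\<R> a \<noteq> 0"
      using discr_nz[OF aK] by (auto simp: discr_2)
    ultimately have "(\<lambda>n. norm (X n a - \<sigma> *\<^sub>R mat 1) / norm (R n a)) \<longlonglongrightarrow> 0 / norm (\<R> a)"
      by (intro tendsto_divide) auto
    moreover have "\<forall>\<^sub>F n in sequentially. norm (R n a) > 0"
      using order_tendstoD(1)[OF R_a, of 0] \<open>\<R> a \<noteq> 0\<close> by simp
    then have "\<forall>\<^sub>F n in sequentially.
        norm (X n a - \<sigma> *\<^sub>R mat 1) / norm (R n a) = inverse (\<gamma> n)"
      using eventually_ge_at_top[of 1]
    proof eventually_elim
      case (elim n)
      have "norm (R n a) = \<gamma> n * norm (X n a - \<sigma> *\<^sub>R mat 1)"
        using R[OF elim(2), of a] \<gamma>_pos[of n] by simp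
      moreover from this have "norm (X n a - \<sigma> *\<^sub>R mat 1) \<noteq> 0" using elim(1) by auto
      ultimately show ?case by (simp add: divide_inverse)
    qed
    ultimately show ?thesis by (simp add: tendsto_cong)
  qed
  have small: "\<forall>\<^sub>F n in sequentially. \<forall>x\<in>K.
      norm (complex_of_real (inverse (\<gamma> n)) * eigval e (R n x)) \<le> 1 / 2" for e
  proof -
    obtain C where C: "C > 0" "\<forall>\<^sub>F n in sequentially. \<forall>x\<in>K. norm (eigval e (R n x)) \<le> C"
      using uniform_limit_eventually_bounded[OF comp on_K lim, OF continuous_on_eigval continuous_on_eigval]
      by auto
    have "\<forall>\<^sub>F n in sequentially. inverse (\<gamma> n) < 1 / (2 * C)"
      using order_tendstoD(2)[OF \<gamma>_lim, of "1 / (2 * C)"] C(1) by simp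
    then show ?thesis using C(2)
    proof eventually_elim
      case (elim n)
      show ?case
      proof
        fix x assume x: "x \<in> K"
        have "norm (complex_of_real (inverse (\<gamma> n)) * eigval e (R n x))
            = inverse (\<gamma> n) * norm (eigval e (R n x))"
          using \<gamma>_pos[of n] by (simp only: norm_mult norm_of_real) simp
        also have "\<dots> \<le> 1 / (2 * C) * C"
          using elim(1) elim(2)[rule_format, OF x] C(1) \<gamma>_pos[of n] by (intro mult_mono) auto
        finally show "norm (complex_of_real (inverse (\<gamma> n)) * eigval e (R n x)) \<le> 1 / 2"
          using C(1) by simp
      qed
    qed
  qed

  obtain r where r: "summable r" "\<And>n. 0 \<le> r n"
      "\<And>n x. n \<ge> 1 \<Longrightarrow> x \<in> K \<Longrightarrow> norm (R (Suc n) x - R n x) \<le> r n"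
  proof -
    have "summable (\<lambda>n. sup_opnorm K ((\<lambda>x. R (Suc (Suc n)) x - R (Suc n) x)))"
      using R_D10 by (simp add: D10_on_def D10_def fun_diff_def)
    then have "\<exists>h. summable h \<and> (\<forall>n. 0 \<le> h n) \<and> (\<forall>n\<ge>1. \<forall>x\<in>K. norm (R (Suc n) x - R n x) \<le> h n)"
      by (intro summable_majorant_of_sup_opnorm[OF comp ne] continuous_on_diff R_cont) auto
    then show ?thesis using that by blast
  qed
  obtain e where e: "summable e" "\<And>n. 0 \<le> e n"
      "\<And>n x. n \<ge> 1 \<Longrightarrow> x \<in> K \<Longrightarrow> norm (E n x) \<le> e n"
    using summable_majorant_of_sup_opnorm[OF comp ne _ E_sum] continuous_on_subset[OF E_cont]
    by auto

  define T where "T n x = eigbasis \<epsilon> c (R n x)" for n x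
  define d where "d \<epsilon> n x = complex_of_real \<sigma> + complex_of_real (inverse (\<gamma> n)) * eigval \<epsilon> (R n x)"
    for \<epsilon> n x
  have "\<forall>\<^sub>F n in sequentially. n \<ge> 1 \<and> (\<forall>x\<in>K. \<delta> \<le> \<tau> * discr (R n x) \<and>
      \<delta>' \<le> norm (det (T n x)) \<and> norm (R n x) \<le> B \<and> norm (T n x) \<le> BT \<and>
      norm (complex_of_real (inverse (\<gamma> n)) * eigval \<epsilon> (R n x)) \<le> 1 / 2 \<and>
      norm (complex_of_real (inverse (\<gamma> n)) * eigval (- \<epsilon>) (R n x)) \<le> 1 / 2)"
    using eventually_ge_at_top[of 1] \<delta>(2) \<delta>'(2) B(2) BT(2) small[of \<epsilon>] small[of "- \<epsilon>"]
    unfolding T_def by eventually_elim blast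
  then obtain N where N: "\<And>n. n \<ge> N \<Longrightarrow> n \<ge> 1"
    and discr_ge: "\<And>n x. n \<ge> N \<Longrightarrow> x \<in> K \<Longrightarrow> \<delta> \<le> \<tau> * discr (R n x)"
    and det_ge: "\<And>n x. n \<ge> N \<Longrightarrow> x \<in> K \<Longrightarrow> \<delta>' \<le> norm (det (T n x))"
    and R_le: "\<And>n x. n \<ge> N \<Longrightarrow> x \<in> K \<Longrightarrow> norm (R n x) \<le> B"
    and T_le: "\<And>n x. n \<ge> N \<Longrightarrow> x \<in> K \<Longrightarrow> norm (T n x) \<le> BT"
    and small_N: "\<And>n x. n \<ge> N \<Longrightarrow> x \<in> K \<Longrightarrow>
        norm (complex_of_real (inverse (\<gamma> n)) * eigval \<epsilon> (R n x)) \<le> 1 / 2"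
      "\<And>n x. n \<ge> N \<Longrightarrow> x \<in> K \<Longrightarrow>
        norm (complex_of_real (inverse (\<gamma> n)) * eigval (- \<epsilon>) (R n x)) \<le> 1 / 2"
    unfolding eventually_sequentially by blast

  have d_bounds: "1 / 2 \<le> norm (d e n x)" "norm (d e n x) \<le> 2"
    if "n \<ge> N" "x \<in> K" "e = \<epsilon> \<or> e = - \<epsilon>" for e n x
  proof -
    let ?y = "complex_of_real (inverse (\<gamma> n)) * eigval e (R n x)"
    have y: "norm ?y \<le> 1 / 2" using small_N[OF that(1,2)] that(3) by blast
    have s: "norm (complex_of_real \<sigma>) = 1" using \<sigma> by auto
    show "1 / 2 \<le> norm (d e n x)"
      using norm_diff_ineq[of "complex_of_real \<sigma>" ?y] y s unfolding d_def by linarith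
    show "norm (d e n x) \<le> 2"
      using norm_triangle_ineq[of "complex_of_real \<sigma>" ?y] y s unfolding d_def by linarith
  qed

  have dichotomy: "(\<forall>n\<ge>N. \<forall>x\<in>K. norm (d \<epsilon> n x) \<le> norm (d (- \<epsilon>) n x)) \<or>
      (\<exists>\<kappa>. (\<forall>n\<ge>N. 0 \<le> \<kappa> n \<and> \<kappa> n \<le> 1 \<and>
              (\<forall>x\<in>K. norm (d (- \<epsilon>) n x) \<le> (1 - \<kappa> n) * norm (d \<epsilon> n x))) \<and>
           filterlim (\<lambda>m. \<Sum>n<m. \<kappa> n) at_top sequentially)"
  proof (cases "\<tau> = 1")
    case False
    then have "norm (d (- \<epsilon>) n x) = norm (d \<epsilon> n x)" if "n \<ge> N" "x \<in> K" for n x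
      unfolding d_def using discr_ge[OF that] \<tau>(1) \<delta>(1)
      by (intro norm_shifted_eigval_neg) auto
    then show ?thesis by simp
  next
    case True
    have diff: "norm (d \<epsilon> n x) - norm (d (- \<epsilon>) n x) = \<sigma> * \<epsilon> * inverse (\<gamma> n) * sqrt (discr (R n x))"
      and sqrt_ge: "sqrt \<delta> \<le> sqrt (discr (R n x))" if "n \<ge> N" "x \<in> K" for n x
    proof -
      have discr: "\<delta> \<le> discr (R n x)" "discr (R n x) > 0"
        using discr_ge[OF that] True \<delta>(1) by auto
      show "sqrt \<delta> \<le> sqrt (discr (R n x))" using discr(1) by simp
      show "norm (d \<epsilon> n x) - norm (d (- \<epsilon>) n x) = \<sigma> * \<epsilon> * inverse (\<gamma> n) * sqrt (discr (R n x))"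
        unfolding d_def by (intro norm_shifted_eigval_diff_pos \<sigma> small_N[OF that] discr(2))
    qed
    show ?thesis
    proof (cases "\<sigma> * \<epsilon> = 1")
      case False
      then have "\<sigma> * \<epsilon> = - 1" using \<sigma> \<epsilon> by auto
      then have "norm (d \<epsilon> n x) \<le> norm (d (- \<epsilon>) n x)" if "n \<ge> N" "x \<in> K" for n x
      proof -
        have "0 \<le> inverse (\<gamma> n) * sqrt (discr (R n x))"
          using \<gamma>_pos[of n] order_trans[OF _ sqrt_ge[OF that], of 0] \<delta>(1) by simp
        then show ?thesis using diff[OF that] \<open>\<sigma> * \<epsilon> = - 1\<close> by simp
      qed
      then show ?thesis by simp
    next
      case \<sigma>\<epsilon>: True
      \<comment> \<open>The gap between the moduli is at least \<open>sqrt \<delta> / \<gamma> n\<close>; the factor \<open>1/2\<close> turns it into a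
        relative gap, since the moduli are at most 2.\<close>
      define \<kappa> where "\<kappa> n = sqrt \<delta> / 2 * (1 / \<gamma> n)" for n
      have \<kappa>_nonneg: "0 \<le> \<kappa> n" for n
        using \<delta>(1) \<gamma>_pos[of n] by (simp add: \<kappa>_def)
      have gap: "norm (d (- \<epsilon>) n x) \<le> (1 - \<kappa> n) * norm (d \<epsilon> n x)" if "n \<ge> N" "x \<in> K" for n x
      proof -
        have "\<kappa> n * norm (d \<epsilon> n x) \<le> \<kappa> n * 2"
          using d_bounds(2)[OF that] \<kappa>_nonneg by (intro mult_left_mono) auto
        also have "\<dots> = inverse (\<gamma> n) * sqrt \<delta>" by (simp add: \<kappa>_def field_simps)
        also have "\<dots> \<le> inverse (\<gamma> n) * sqrt (discr (R n x))"
          using sqrt_ge[OF that] \<gamma>_pos[of n] by (intro mult_left_mono) auto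
        also have "\<dots> = norm (d \<epsilon> n x) - norm (d (- \<epsilon>) n x)"
          using diff[OF that] \<sigma>\<epsilon> by simp
        finally show ?thesis by (simp add: algebra_simps)
      qed
      \<comment> \<open>A modulus is not negative, so the relative gap cannot exceed 1.\<close>
      have "\<kappa> n \<le> 1" if "n \<ge> N" for n
      proof -
        have "0 \<le> (1 - \<kappa> n) * norm (d \<epsilon> n a)"
          using order_trans[OF norm_ge_zero gap[OF that aK]] .
        then show ?thesis
          using d_bounds(1)[OF that aK, of \<epsilon>] by (auto simp: zero_le_mult_iff)
      qed
      moreover have "filterlim (\<lambda>m. \<Sum>n<m. \<kappa> n) at_top sequentially"
      proof -
        have "filterlim (\<lambda>m. \<Sum>n<m. 1 / \<gamma> n) at_top sequentially"
          using \<tau>(2) True by (intro \<gamma>_div) auto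
        then have "filterlim (\<lambda>m. sqrt \<delta> / 2 * (\<Sum>n<m. 1 / \<gamma> n)) at_top sequentially"
          using \<delta>(1) by (intro filterlim_tendsto_pos_mult_at_top[OF tendsto_const]) auto
        then show ?thesis by (simp only: \<kappa>_def sum_distrib_left)
      qed
      ultimately show ?thesis using \<kappa>_nonneg gap by blast
    qed
  qed

  have diag: "cmat (X n x) *v (T n x *v u) = T n x *v (diag2 (d \<epsilon> n x) (d (- \<epsilon>) n x) *v u)"
    if "n \<ge> N" "x \<in> K" for n x u
  proof -
    let ?g = "complex_of_real (inverse (\<gamma> n))"
    have "X n x = \<sigma> *\<^sub>R mat 1 + inverse (\<gamma> n) *\<^sub>R R n x"
      using R[OF N[OF that(1)], of x] \<gamma>_pos[of n] by simp
    then have "cmat (X n x) *v w = complex_of_real \<sigma> *s w + ?g *s (cmat (R n x) *v w)" for w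
      by (simp add: vec_eq_iff forall_2 matrix_vector_mult_2 mat_def algebra_simps)
    then have "cmat (X n x) *v (T n x *v u) = complex_of_real \<sigma> *s (T n x *v u)
        + ?g *s (T n x *v (diag2 (eigval \<epsilon> (R n x)) (eigval (- \<epsilon>) (R n x)) *v u))"
      by (simp only: T_def eigbasis_diagonalizes[OF \<epsilon>'(1)])
    also have "\<dots> = T n x *v (complex_of_real \<sigma> *s u
        + ?g *s (diag2 (eigval \<epsilon> (R n x)) (eigval (- \<epsilon>) (R n x)) *v u))"
      by (simp only: matrix_vector_right_distrib vector_scalar_commute)
    also have "complex_of_real \<sigma> *s u
        + ?g *s (diag2 (eigval \<epsilon> (R n x)) (eigval (- \<epsilon>) (R n x)) *v u)
        = diag2 (d \<epsilon> n x) (d (- \<epsilon>) n x) *v u"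
      by (simp add: vec_eq_iff diag2_mult_component d_def algebra_simps)
    finally show ?thesis .
  qed

  have T_diff: "norm (T (Suc n) x - T n x) \<le> (8 + 32 * B / sqrt \<delta>) * norm c * r n"
    if "n \<ge> N" "x \<in> K" for n x
  proof -
    have "norm (T (Suc n) x - T n x)
        \<le> (8 + 32 * B / sqrt \<delta>) * norm c * norm (R (Suc n) x - R n x)"
      unfolding T_def using that
      by (intro eigbasis_lipschitz[OF \<tau>(1) \<delta>(1)] discr_ge R_le \<epsilon>'(2)) auto
    also have "\<dots> \<le> (8 + 32 * B / sqrt \<delta>) * norm c * r n"
      using r(3)[OF N[OF that(1)] that(2)] B(1) \<delta>(1) by (intro mult_left_mono) auto
    finally show ?thesis .
  qed

  have inverse_le: "norm (inverse2 (T n x)) \<le> 4 * BT / \<delta>'" if "n \<ge> N" "x \<in> K" for n x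
  proof -
    have "4 * norm (T n x) / norm (det (T n x)) \<le> 4 * BT / \<delta>'"
      using T_le[OF that] det_ge[OF that] \<delta>'(1) BT(1) by (intro frac_le) auto
    then show ?thesis using norm_inverse2_le[of "T n x"] by linarith
  qed
  have along_R: "continuous_on K (\<lambda>x. f (R n x))" if "n \<ge> N" "continuous_on UNIV f"
    for n and f :: "real^2^2 \<Rightarrow> 'z::metric_space"
    using continuous_on_compose2[OF that(2) R_cont[OF N[OF that(1)]]] by simp
  have cmat_cont: "continuous_on K (\<lambda>x. cmat (X n x))" if "n \<ge> N" for n
    unfolding map_matrix_def using continuous_on_subset[OF X_cont[OF N[OF that]]]
    by (intro continuous_on_vec_lambda continuous_on_of_real continuous_on_component) auto

  have "\<exists>n0\<ge>N. \<exists>\<Phi> L. (\<forall>n\<ge>n0. continuous_on K (\<Phi> n)) \<and> continuous_on K L \<and>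
           (\<forall>x\<in>K. L x \<noteq> 0) \<and>
           (\<forall>n\<ge>n0. \<forall>x\<in>K. \<Phi> (Suc n) x = (cmat (X n x) + E n x) *v \<Phi> n x) \<and>
           uniform_limit K (\<lambda>n x. inverse (\<Prod>j=n0..<n. d \<epsilon> j x) *s \<Phi> n x)
             (\<lambda>x. eigbasis \<epsilon> c (\<R> x) *v (L x *s axis 1 1)) sequentially"
  proof (rule levinson_diagonalizable[where A = "\<lambda>n x. cmat (X n x)" and d' = "d (- \<epsilon>)"])
    show "continuous_on K (E n)" if "n \<ge> N" for n
      using continuous_on_subset[OF E_cont[OF N[OF that]]] by simp
    show "continuous_on K (T n)" if "n \<ge> N" for n
      unfolding T_def by (rule along_R[OF that T_cont])
    show "continuous_on K (d \<epsilon> n)" if "n \<ge> N" for n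
      unfolding d_def by (intro continuous_intros along_R[OF that continuous_on_eigval])
    show "det (T n x) \<noteq> 0" if "n \<ge> N" "x \<in> K" for n x
      using det_ge[OF that] \<delta>'(1) by auto
    show "summable (\<lambda>n. (8 + 32 * B / sqrt \<delta>) * norm c * r n)"
      using r(1) by (rule summable_mult)
    show "0 \<le> (8 + 32 * B / sqrt \<delta>) * norm c * r n" for n
      using r(2) B(1) \<delta>(1) by (intro mult_nonneg_nonneg add_nonneg_nonneg) auto
    show "norm (E n x) \<le> e n" if "n \<ge> N" "x \<in> K" for n x
      using e(3) N that by auto
    show "continuous_on K (\<lambda>x. eigbasis \<epsilon> c (\<R> x))" by (rule on_K[OF T_cont])
    show "uniform_limit K T (\<lambda>x. eigbasis \<epsilon> c (\<R> x)) sequentially"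
      unfolding T_def by (rule lim[OF T_cont])
    show "0 \<le> BT" "0 \<le> 4 * BT / \<delta>'" using BT(1) \<delta>'(1) by auto
  qed (fact comp cmat_cont diag T_le inverse_le T_diff e dichotomy | blast intro: d_bounds)+
  then obtain n0 \<Phi> L where n0: "n0 \<ge> N"
    and \<Phi>: "\<forall>n\<ge>n0. continuous_on K (\<Phi> n)"
      "\<forall>n\<ge>n0. \<forall>x\<in>K. \<Phi> (Suc n) x = (cmat (X n x) + E n x) *v \<Phi> n x"
    and L: "continuous_on K L" "\<And>x. x \<in> K \<Longrightarrow> L x \<noteq> 0"
    and \<Phi>_lim: "uniform_limit K (\<lambda>n x. inverse (\<Prod>j=n0..<n. d \<epsilon> j x) *s \<Phi> n x)
             (\<lambda>x. eigbasis \<epsilon> c (\<R> x) *v (L x *s axis 1 1)) sequentially"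
    by blast
  define v where "v x = eigbasis \<epsilon> c (\<R> x) *v (L x *s axis 1 1)" for x
  define \<mu> where "\<mu> n x = eigval \<epsilon> (R n x)" for n x

  have v_cont: "continuous_on K v"
    unfolding v_def vector_scalar_mult_def using L(1)
    by (intro continuous_on_matrix_vector_mult on_K[OF T_cont] continuous_on_vec_lambda
        continuous_on_mult continuous_on_const)
  have v_eig: "eigenvector (cmat (\<R> x)) (v x) (\<eta> x)" if "x \<in> K" for x
    unfolding v_def \<eta>[OF that] by (intro eigenvector_eigbasis \<epsilon>'(1) det_nz \<tau>(2) L(2) that)
  have \<mu>_eig: "eigenvalue (cmat (R n x)) (\<mu> n x)" if "n \<ge> n0" "x \<in> K" for n x
  proof -
    have "\<tau> * discr (R n x) > 0" using discr_ge[of n x] \<delta>(1) that n0 by auto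
    then show ?thesis
      using eigenvector_eigbasis[OF \<epsilon>'(1) det_nz, of "R n x" 1]
      by (auto simp: eigenvalue_def \<mu>_def)
  qed
  have \<mu>_lim: "uniform_limit K \<mu> \<eta> sequentially"
    using lim[OF continuous_on_eigval[of \<epsilon>]] \<eta> by (simp add: \<mu>_def uniform_limit_iff)
  have \<mu>_cont: "continuous_on K (\<mu> n)" if "n \<ge> n0" for n
    unfolding \<mu>_def using that n0 by (intro along_R continuous_on_eigval) auto
  show ?thesis
  proof (intro exI[of _ n0] exI[of _ \<Phi>] exI[of _ \<mu>] exI[of _ v] conjI allI impI ballI)
    show "1 \<le> n0" using N n0 by auto
    show "(\<lambda>n. SUP x\<in>K. norm (inverse (\<Prod>j=n0..<n. complex_of_real \<sigma> +
        complex_of_real (inverse (\<gamma> j)) * \<mu> j x) *s \<Phi> n x - v x)) \<longlonglongrightarrow> 0"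
      using uniform_limit_imp_SUP_tendsto_0[OF \<Phi>_lim ne] unfolding d_def v_def \<mu>_def .
    show "(\<lambda>n. SUP x\<in>K. norm (\<mu> n x - \<eta> x)) \<longlonglongrightarrow> 0"
      by (rule uniform_limit_imp_SUP_tendsto_0[OF \<mu>_lim ne])
  qed (use \<Phi> v_cont v_eig \<mu>_eig \<mu>_cont in auto)
qed

end
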